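(* Let $0<R<1$ and let $f,g\in L^\infty(A_{1,R})$ have polar decompositions $$f(re^{i\theta})=\sum_{k=-\infty}^{M}f_k(r)e^{ik\theta},\qquad g(re^{i\theta})=\sum_{k=-\infty}^{N}g_k(r)e^{ik\theta}$$ for some $M,N\in\mathbb{Z}$ (that is, $f_k=0$ for $k>M$ and $g_k=0$ for $k>N$). Assume that $n_0\in\mathbb{Z}$ is the smallest integer such that $\widehat{g_N}(2n+N+2)\neq 0$ for all integers $n\ge n_0$. If $T_fT_g=0$ on $B^2(A_{1,R})$, then $f=0$ (almost everywhere on $A_{1,R}$).
   Context: $A_{1,R}=\{z\in\mathbb{C}:R<|z|<1\}$. The Bergman space $B^2(A_{1,R})$ is the space of holomorphic functions on $A_{1,R}$ that are square integrable with respect to area measure $dA=dx\,dy$, with inner product $\langle f,g\rangle=\frac1{2\pi}\int_{A_{1,R}}f(z)\overline{g(z)}\,dA(z)$; it is a closed subspace of $L^2(A_{1,R},dA)$. Let $P$ be the orthogonal projection of $L^2(A_{1,R},dA)$ onto $B^2(A_{1,R})$. For $f\in L^\infty(A_{1,R})$ (essentially bounded functions), the Toeplitz operator $T_f:B^2(A_{1,R})\to B^2(A_{1,R})$ is $T_f\varphi=P(f\varphi)$. Any $f\in L^2(A_{1,R},dA)$ has a polar decomposition $f(re^{i\theta})=\sum_{k\in\mathbb{Z}}f_k(r)e^{ik\theta}$, where $f_k(r)=\frac1{2\pi}\int_0^{2\pi}f(re^{i\theta})e^{-ik\theta}\,d\theta$ belongs to $L^2([R,1],r\,dr)$. The Mellin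 transform of $\phi\in L^1([R,1],r\,dr)$ is $\widehat{\phi}(z)=\int_R^1\phi(r)r^{z-1}\,dr$. *)

theory Defs
  imports "HOL-Analysis.Analysis"
begin

definition annulus :: "real \<Rightarrow> complex set" where
  "annulus R = {z. R < norm z \<and> norm z < 1}"

text \<open>Elements of \<open>L\<^sup>2\<close> and \<open>L\<^sup>\<infinity>\<close> are represented by functions on the whole plane of which only
  the values on the annulus matter; two functions represent the same element if they agree almost
  everywhere with respect to \<^term>\<open>lebesgue_on (annulus R)\<close>.\<close>

definition L2_annulus :: "real \<Rightarrow> (complex \<Rightarrow> complex) set" where
  "L2_annulus R = {h. h \<in> borel_measurable (lebesgue_on (annulus R)) \<and>
                      integrable (lebesgue_on (annulus R)) (\<lambda>z. (norm (h z))\<^sup>2)}"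

definition Linf_annulus :: "real \<Rightarrow> (complex \<Rightarrow> complex) set" where
  "Linf_annulus R = {h. h \<in> borel_measurable (lebesgue_on (annulus R)) \<and>
                        (\<exists>C. AE z in lebesgue_on (annulus R). norm (h z) \<le> C)}"

definition inner_annulus :: "real \<Rightarrow> (complex \<Rightarrow> complex) \<Rightarrow> (complex \<Rightarrow> complex) \<Rightarrow> complex" where
  "inner_annulus R h k =
     1 / (2 * of_real pi) * (LINT z | lebesgue_on (annulus R). h z * cnj (k z))"

text \<open>Members of the Bergman space are normalised to vanish off the annulus, so that functions
  which agree on the annulus are equal.\<close>

definition bergman :: "real \<Rightarrow> (complex \<Rightarrow> complex) set" where
  "bergman R = {\<phi>. \<phi> holomorphic_on annulus R \<and> \<phi> \<in> L2_annulus R \<and> (\<forall>z. z \<notin> annulus R \<longrightarrow> \<phi> z = 0)}"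

text \<open>For \<open>h\<close> in \<open>L\<^sup>2\<close> the description is proper: the Bergman space is a closed subspace of
  \<open>L\<^sup>2\<close>, and a holomorphic function vanishing almost everywhere vanishes on the annulus.\<close>

definition bergman_proj :: "real \<Rightarrow> (complex \<Rightarrow> complex) \<Rightarrow> (complex \<Rightarrow> complex)" where
  "bergman_proj R h =
     (THE u. u \<in> bergman R \<and> (\<forall>\<phi>\<in>bergman R. inner_annulus R (\<lambda>z. h z - u z) \<phi> = 0))"

definition toeplitz :: "real \<Rightarrow> (complex \<Rightarrow> complex) \<Rightarrow> (complex \<Rightarrow> complex) \<Rightarrow> (complex \<Rightarrow> complex)" where
  "toeplitz R f \<phi> = bergman_proj R (\<lambda>z. f z * \<phi> z)"

text \<open>The section \<open>\<theta> \<mapsto> f (r e\<^sup>i\<^sup>\<theta>)\<close> of a Lebesgue measurable \<open>f\<close> is Lebesgue but not necessarily Borel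
  measurable (for almost every \<open>r\<close>), hence the integrals over \<^term>\<open>lebesgue\<close> rather than
  \<^term>\<open>lborel\<close> here and in the Mellin transform.\<close>

definition polar_coeff :: "(complex \<Rightarrow> complex) \<Rightarrow> int \<Rightarrow> real \<Rightarrow> complex" where
  "polar_coeff f k r =
     1 / (2 * of_real pi) * (LINT \<theta> | lebesgue_on {0..2*pi}. f (rcis r \<theta>) * cis (- of_int k * \<theta>))"

definition mellin :: "real \<Rightarrow> (real \<Rightarrow> complex) \<Rightarrow> complex \<Rightarrow> complex" where
  "mellin R \<phi> z = (LINT r | lebesgue_on {R..1}. \<phi> r * of_real r powr (z - 1))"

end

theory Submission
  imports Defs "HOL-Complex_Analysis.Complex_Analysis"
begin

text \<open>Write \<open>\<langle>h z\<^sup>a, z\<^sup>b\<rangle>\<close>, up to the factor \<open>1 / 2\<pi>\<close>, for the moment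
\<open>\<integral> h z\<^sup>a cnj(z)\<^sup>b dA\<close> of a bounded symbol \<open>h\<close>.  In polar coordinates it is a Mellin coefficient of
\<open>h\<^bsub>b-a\<^esub>\<close>, so the hypotheses say that the moments of \<open>f\<close> vanish when \<open>b - a > M\<close>, those of \<open>g\<close> when
\<open>b - a > N\<close>, and that \<open>\<langle>g z\<^sup>n, z\<^bsup>n+N\<^esup>\<rangle> \<noteq> 0\<close> for \<open>n \<ge> n\<^sub>0\<close>.

Suppose the moments of \<open>f\<close> vanish whenever \<open>b - a > K\<close>, and let \<open>u = T\<^sub>g z\<^sup>n\<close> with \<open>n \<ge> n\<^sub>0\<close>.  The Laurent
expansion of \<open>u\<close> has its top term at \<open>z\<^sup>J\<close>, where \<open>J = n + N\<close>, with a coefficient \<open>c \<noteq> 0\<close>.  Since \<open>f\<close> raises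
degrees by at most \<open>K\<close>, only this term contributes to the coefficient of \<open>T\<^sub>f u\<close> at \<open>z\<^bsup>J+K\<^esup>\<close>, and
\<open>T\<^sub>f u = 0\<close> gives \<open>\<langle>f z\<^sup>J, z\<^bsup>J+K\<^esup>\<rangle> = 0\<close> for every \<open>J \<ge> n\<^sub>0 + N\<close> (lemma \<open>top_moment_zero\<close>).  Moments
with the same \<open>b - a\<close> differ by powers of \<open>|z|\<^sup>2\<close> under the integral, and on \<open>[R\<^sup>2, 1]\<close> every continuous function
of \<open>|z|\<^sup>2\<close>, negative powers included, is a uniform limit of polynomials; hence these moments vanish for all \<open>J\<close>
(lemma \<open>moment_extend\<close>).  Now the hypothesis holds with \<open>K - 1\<close> in place of \<open>K\<close>.  Descending from \<open>K = M\<close>, all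
moments of \<open>f\<close> vanish, so \<open>f\<close> is orthogonal to the polynomials in \<open>z\<close> and \<open>cnj z\<close>, which are dense, and
\<open>f = 0\<close> almost everywhere (lemma \<open>Linf_eq_0_of_moments\<close>).

Three analytic facts support this.  Polar coordinates come from the rotation invariance of planar Lebesgue measure
and the area of discs.  The orthogonal projection onto the Bergman space exists because a distance-minimising
sequence in that space converges locally uniformly, by the area mean value inequality, and Fatou's lemma shows that
its limit attains the distance.  That only the top Laurent term contributes is a
statement about Fourier series: if \<open>w\<close> in the Bergman space is orthogonal to \<open>z\<^sup>j\<close> for \<open>j \<ge> J\<close>, and \<open>h\<close>
is bounded with compact support and \<open>\<integral> h(z) z\<^sup>j dA = 0\<close> for \<open>j < J\<close>, then the continuous function
\<open>\<zeta> \<mapsto> \<integral> h(z) w(\<zeta> z) dA\<close> on the unit circle has no nonzero Fourier coefficient, so that it vanishes at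
\<open>\<zeta> = 1\<close> (lemma \<open>product_integral_zero_compact_support\<close>); radial cutoffs remove the restriction on the support
(lemma \<open>product_integral_zero\<close>).\<close>

section \<open>Rotation invariance of planar Lebesgue measure\<close>

lemma lborel_complex_eq_distr_pair:
  "(lborel :: complex measure) = distr (lborel \<Otimes>\<^sub>M lborel) borel (\<lambda>(x, y). Complex x y)"
proof (rule lborel_eqI)
  have [measurable]: "(\<lambda>p :: real \<times> real. Complex (fst p) (snd p)) \<in> borel_measurable borel"
    by (intro borel_measurable_continuous_onI continuous_intros)
  fix l u :: complex
  assume le: "\<And>b. b \<in> Basis \<Longrightarrow> l \<bullet> b \<le> u \<bullet> b"
  have le1: "Re l \<le> Re u" "Im l \<le> Im u"
    using le[of 1] le[of \<i>] by (auto simp: Basis_complex_def)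
  have eq: "(\<lambda>(x, y). Complex x y) -` box l u = box (Re l) (Re u) \<times> box (Im l) (Im u)"
    by (auto simp: box_def Basis_complex_def)
  have "emeasure (distr (lborel \<Otimes>\<^sub>M lborel) borel (\<lambda>(x, y). Complex x y)) (box l u) =
     emeasure (lborel \<Otimes>\<^sub>M lborel) (box (Re l) (Re u) \<times> box (Im l) (Im u))"
    by (subst emeasure_distr) (simp_all add: eq lborel_prod space_pair_measure case_prod_beta del: box_real)
  also have "\<dots> = ennreal ((Re u - Re l) * (Im u - Im l))"
    using le1 by (subst lborel.emeasure_pair_measure_Times) (auto simp: ennreal_mult)
  also have "(Re u - Re l) * (Im u - Im l) = (\<Prod>b\<in>Basis. (u - l) \<bullet> b)"
    by (simp add: Basis_complex_def)
  finally show "emeasure (distr (lborel \<Otimes>\<^sub>M lborel) borel (\<lambda>(x, y). Complex x y)) (box l u) =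
     ennreal (\<Prod>b\<in>Basis. (u - l) \<bullet> b)" .
qed simp

lemma nn_integral_complex_iterated:
  fixes h :: "complex \<Rightarrow> ennreal"
  assumes [measurable]: "h \<in> borel_measurable borel"
  shows "(\<integral>\<^sup>+z. h z \<partial>lborel) = (\<integral>\<^sup>+y. \<integral>\<^sup>+x. h (Complex x y) \<partial>lborel \<partial>lborel)"
    and "(\<integral>\<^sup>+z. h z \<partial>lborel) = (\<integral>\<^sup>+x. \<integral>\<^sup>+y. h (Complex x y) \<partial>lborel \<partial>lborel)"
proof -
  have [measurable]: "(\<lambda>p :: real \<times> real. Complex (fst p) (snd p)) \<in> borel_measurable borel"
    by (intro borel_measurable_continuous_onI continuous_intros)
  have [measurable]: "(\<lambda>p :: real \<times> real. Complex (fst p) (snd p)) \<in> borel_measurable (lborel \<Otimes>\<^sub>M lborel)"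
    by (simp add: lborel_prod)
  have "(\<integral>\<^sup>+z. h z \<partial>lborel) = (\<integral>\<^sup>+p. h (Complex (fst p) (snd p)) \<partial>(lborel \<Otimes>\<^sub>M lborel))"
    by (subst lborel_complex_eq_distr_pair, subst nn_integral_distr) (auto simp: case_prod_beta)
  moreover have "\<dots> = (\<integral>\<^sup>+x. \<integral>\<^sup>+y. h (Complex x y) \<partial>lborel \<partial>lborel)"
    by (subst lborel.nn_integral_fst[symmetric]) auto
  moreover have "\<dots> = (\<integral>\<^sup>+y. \<integral>\<^sup>+x. h (Complex x y) \<partial>lborel \<partial>lborel)"
    by (rule lborel_pair.Fubini'[symmetric]) (simp add: case_prod_beta)
  ultimately show "(\<integral>\<^sup>+z. h z \<partial>lborel) = (\<integral>\<^sup>+y. \<integral>\<^sup>+x. h (Complex x y) \<partial>lborel \<partial>lborel)"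
    and "(\<integral>\<^sup>+z. h z \<partial>lborel) = (\<integral>\<^sup>+x. \<integral>\<^sup>+y. h (Complex x y) \<partial>lborel \<partial>lborel)"
    by simp_all
qed

lemma nn_integral_lborel_shift:
  fixes h :: "real \<Rightarrow> ennreal"
  assumes [measurable]: "h \<in> borel_measurable borel"
  shows "(\<integral>\<^sup>+x. h (c + x) \<partial>lborel) = (\<integral>\<^sup>+x. h x \<partial>lborel)"
proof -
  have "(\<integral>\<^sup>+x. h x \<partial>lborel) = (\<integral>\<^sup>+x. h x \<partial>(distr lborel borel ((+) c)))"
    by (simp add: lborel_distr_plus)
  also have "\<dots> = (\<integral>\<^sup>+x. h (c + x) \<partial>lborel)"
    by (subst nn_integral_distr) auto
  finally show ?thesis by simp
qed

lemma nn_integral_shear_Re: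
  fixes h :: "complex \<Rightarrow> ennreal"
  assumes [measurable]: "h \<in> borel_measurable borel"
  shows "(\<integral>\<^sup>+z. h (Complex (Re z + t * Im z) (Im z)) \<partial>lborel) = (\<integral>\<^sup>+z. h z \<partial>lborel)"
proof -
  have [measurable]: "(\<lambda>z. Complex (Re z + t * Im z) (Im z)) \<in> borel_measurable borel"
     "(\<lambda>x. Complex x y) \<in> borel_measurable borel" for y
    by (intro borel_measurable_continuous_onI continuous_intros)+
  have "(\<integral>\<^sup>+z. h (Complex (Re z + t * Im z) (Im z)) \<partial>lborel) =
     (\<integral>\<^sup>+y. \<integral>\<^sup>+x. h (Complex (t * y + x) y) \<partial>lborel \<partial>lborel)"
    by (subst nn_integral_complex_iterated(1)) (auto simp: add.commute)
  also have "\<dots> = (\<integral>\<^sup>+y. \<integral>\<^sup>+x. h (Complex x y) \<partial>lborel \<partial>lborel)"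
    by (intro nn_integral_cong nn_integral_lborel_shift) auto
  finally show ?thesis by (simp add: nn_integral_complex_iterated(1))
qed

lemma nn_integral_shear_Im:
  fixes h :: "complex \<Rightarrow> ennreal"
  assumes [measurable]: "h \<in> borel_measurable borel"
  shows "(\<integral>\<^sup>+z. h (Complex (Re z) (Im z + t * Re z)) \<partial>lborel) = (\<integral>\<^sup>+z. h z \<partial>lborel)"
proof -
  have [measurable]: "(\<lambda>z. Complex (Re z) (Im z + t * Re z)) \<in> borel_measurable borel"
     "(\<lambda>y. Complex x y) \<in> borel_measurable borel" for x
    by (intro borel_measurable_continuous_onI continuous_intros)+
  have "(\<integral>\<^sup>+z. h (Complex (Re z) (Im z + t * Re z)) \<partial>lborel) =
     (\<integral>\<^sup>+x. \<integral>\<^sup>+y. h (Complex x (t * x + y)) \<partial>lborel \<partial>lborel)"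
    by (subst nn_integral_complex_iterated(2)) (auto simp: add.commute)
  also have "\<dots> = (\<integral>\<^sup>+x. \<integral>\<^sup>+y. h (Complex x y) \<partial>lborel \<partial>lborel)"
    by (intro nn_integral_cong nn_integral_lborel_shift) auto
  finally show ?thesis by (simp add: nn_integral_complex_iterated(2))
qed

text \<open>A rotation other than the half turn is a product of three shears,
\<open>(x, y) \<mapsto> (x + t y, y)\<close>, \<open>(x, y) \<mapsto> (x, y + s x)\<close> and the first one again, with \<open>s = sin \<alpha>\<close> and
\<open>t = - tan (\<alpha> / 2)\<close>, where \<open>\<zeta> = e\<^bsup>i\<alpha>\<^esup>\<close>.  Shears preserve area by Fubini's theorem and translation invariance on the line.  The half
turn is the square of a quarter turn.\<close>

lemma nn_integral_rotate:
  fixes h :: "complex \<Rightarrow> ennreal"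
  assumes [measurable]: "h \<in> borel_measurable borel" and z1: "norm \<zeta> = 1"
  shows "(\<integral>\<^sup>+z. h (\<zeta> * z) \<partial>lborel) = (\<integral>\<^sup>+z. h z \<partial>lborel)"
proof -
  have main: "(\<integral>\<^sup>+z. k (\<xi> * z) \<partial>lborel) = (\<integral>\<^sup>+z. k z \<partial>lborel)"
    if [measurable]: "k \<in> borel_measurable borel" and x1: "norm \<xi> = 1" and ne: "\<xi> \<noteq> -1" for k :: "complex \<Rightarrow> ennreal" and \<xi>
  proof -
    define c s t where "c = Re \<xi>" and "s = Im \<xi>" and "t = - (Im \<xi> / (1 + Re \<xi>))"
    have cs: "c^2 + s^2 = 1"
      using x1 by (simp add: c_def s_def cmod_def)
    have "c \<noteq> -1"
      using ne cs by (auto simp: c_def s_def complex_eq_iff)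
    hence c0: "1 + c \<noteq> 0" by linarith
    have "s * s = (1 - c) * (1 + c)"
      using cs by (simp add: power2_eq_square algebra_simps)
    hence st: "1 + s * t = c"
      unfolding t_def c_def[symmetric] s_def[symmetric] using c0 by (simp add: field_simps)
    have t1: "t * (1 + c) = - s"
      using c0 by (simp add: t_def c_def s_def)
    have [measurable]: "(\<lambda>z. Complex (Re z) (Im z + s * Re z)) \<in> borel_measurable borel"
      "(\<lambda>z. Complex (Re z + t * Im z) (Im z)) \<in> borel_measurable borel"
      "(\<lambda>z. Complex (Re z + t * (Im z + s * Re z)) (Im z + s * Re z)) \<in> borel_measurable borel"
      by (intro borel_measurable_continuous_onI continuous_intros)+
    have eq: "\<xi> * z = Complex (x1 + t * y1) y1"
      if "x1 = Re z + t * Im z" "y1 = Im z + s * x1" for z x1 y1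
    proof -
      have y: "y1 = s * Re z + c * Im z"
        unfolding that st[symmetric] by (simp add: algebra_simps)
      have "x1 + t * y1 = (1 + s * t) * Re z + (t * (1 + c)) * Im z"
        unfolding y that(1) by (simp add: algebra_simps)
      also have "\<dots> = c * Re z - s * Im z"
        unfolding st t1 by simp
      finally show ?thesis
        by (simp add: complex_eq_iff y c_def s_def)
    qed
    have "(\<integral>\<^sup>+z. k z \<partial>lborel) = (\<integral>\<^sup>+z. k (Complex (Re z + t * Im z) (Im z)) \<partial>lborel)"
      by (simp add: nn_integral_shear_Re)
    also have "\<dots> = (\<integral>\<^sup>+z. (\<lambda>z. k (Complex (Re z + t * Im z) (Im z)))
          (Complex (Re z) (Im z + s * Re z)) \<partial>lborel)"
      by (subst nn_integral_shear_Im) simp_all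
    also have "\<dots> = (\<integral>\<^sup>+z. (\<lambda>z. (\<lambda>z. k (Complex (Re z + t * Im z) (Im z)))
          (Complex (Re z) (Im z + s * Re z))) (Complex (Re z + t * Im z) (Im z)) \<partial>lborel)"
      by (subst nn_integral_shear_Re) simp_all
    also have "\<dots> = (\<integral>\<^sup>+z. k (\<xi> * z) \<partial>lborel)"
      by (intro nn_integral_cong arg_cong[of _ _ k]) (simp add: eq[OF refl refl])
    finally show ?thesis by simp
  qed
  show ?thesis
  proof (cases "\<zeta> = -1")
    case True
    have i: "norm \<i> = 1" "\<i> \<noteq> -1"
      by (auto simp: complex_eq_iff)
    have "(\<integral>\<^sup>+z. h (\<i> * (\<i> * z)) \<partial>lborel) = (\<integral>\<^sup>+z. h (\<i> * z) \<partial>lborel)"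
      by (rule main[OF _ i]) simp
    also have "\<dots> = (\<integral>\<^sup>+z. h z \<partial>lborel)"
      by (rule main[OF _ i]) simp
    finally show ?thesis
      using True by (simp flip: mult.assoc)
  qed (use main[of h] z1 in auto)
qed

lemma nn_integral_lebesgue_on_borel:
  fixes h :: "'a::euclidean_space \<Rightarrow> ennreal"
  assumes [measurable]: "h \<in> borel_measurable borel" "S \<in> sets borel"
  shows "(\<integral>\<^sup>+z. h z \<partial>lebesgue_on S) = (\<integral>\<^sup>+z. indicator S z * h z \<partial>lborel)"
proof -
  have "(\<integral>\<^sup>+z. h z \<partial>lebesgue_on S) = (\<integral>\<^sup>+z. h z * indicator S z \<partial>lebesgue)"
    by (subst nn_integral_restrict_space) auto
  also have "\<dots> = (\<integral>\<^sup>+z. h z * indicator S z \<partial>lborel)"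
    by (subst nn_integral_completion) auto
  finally show ?thesis by (simp add: mult.commute)
qed

lemma nn_integral_rotate_on:
  fixes h :: "complex \<Rightarrow> ennreal"
  assumes [measurable]: "h \<in> borel_measurable borel" "S \<in> sets borel"
    and z1: "norm \<zeta> = 1" and inv: "\<And>z. \<zeta> * z \<in> S \<longleftrightarrow> z \<in> S"
  shows "(\<integral>\<^sup>+z. h (\<zeta> * z) \<partial>lebesgue_on S) = (\<integral>\<^sup>+z. h z \<partial>lebesgue_on S)"
proof -
  have "(\<integral>\<^sup>+z. indicator S (\<zeta> * z) * h (\<zeta> * z) \<partial>lborel) = (\<integral>\<^sup>+z. indicator S z * h z \<partial>lborel)"
    by (rule nn_integral_rotate) (use z1 in auto)
  moreover have "indicator S (\<zeta> * z) = (indicator S z :: ennreal)" for z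
    using inv by (auto simp: indicator_def)
  ultimately show ?thesis
    by (simp add: nn_integral_lebesgue_on_borel)
qed

lemma borel_measurable_lebesgue_on:
  "h \<in> measurable borel N \<Longrightarrow> h \<in> measurable (lebesgue_on S) N"
  by (intro measurable_restrict_space1 measurable_completion) simp

text \<open>The product of two completed measures is not complete, so joint measurability is available for Borel functions but
not for arbitrary Lebesgue measurable ones.  This is why symbols are replaced by Borel representatives below.\<close>

lemma borel_measurable_lebesgue_on_pair:
  assumes h: "h \<in> measurable (borel \<Otimes>\<^sub>M borel) N"
  shows "h \<in> measurable (lebesgue_on S \<Otimes>\<^sub>M lebesgue_on T) N"
proof -
  have "(\<lambda>p. (fst p, snd p)) \<in> measurable (lebesgue_on S \<Otimes>\<^sub>M lebesgue_on T) (borel \<Otimes>\<^sub>M borel)"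
    by (intro measurable_Pair measurable_compose[OF measurable_fst] measurable_compose[OF measurable_snd]
        borel_measurable_lebesgue_on) simp_all
  from measurable_compose[OF this h] show ?thesis by simp
qed

lemma distr_rotate_on:
  fixes S :: "complex set"
  assumes [measurable]: "S \<in> sets borel"
    and z1: "norm \<zeta> = 1" and inv: "\<And>z. \<zeta> * z \<in> S \<longleftrightarrow> z \<in> S"
  shows "distr (lebesgue_on S) borel (\<lambda>z. \<zeta> * z) = distr (lebesgue_on S) borel (\<lambda>z. z)"
proof (rule measure_eqI)
  have [measurable]: "(\<lambda>z. z) \<in> borel_measurable (lebesgue_on S)" "(\<lambda>z. \<zeta> * z) \<in> borel_measurable (lebesgue_on S)"
    by (intro borel_measurable_lebesgue_on, measurable)+
  fix B assume "B \<in> sets (distr (lebesgue_on S) borel (\<lambda>z. \<zeta> * z))"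
  hence B [measurable]: "B \<in> sets borel" by simp
  have "emeasure (distr (lebesgue_on S) borel (\<lambda>z. \<zeta> * z)) B =
      (\<integral>\<^sup>+z. indicator B z \<partial>distr (lebesgue_on S) borel (\<lambda>z. \<zeta> * z))"
    by (subst nn_integral_indicator) auto
  also have "\<dots> = (\<integral>\<^sup>+z. indicator B (\<zeta> * z) \<partial>lebesgue_on S)"
    by (subst nn_integral_distr) auto
  also have "\<dots> = (\<integral>\<^sup>+z. indicator B z \<partial>lebesgue_on S)"
    by (rule nn_integral_rotate_on) (use assms in auto)
  also have "\<dots> = (\<integral>\<^sup>+z. indicator B z \<partial>distr (lebesgue_on S) borel (\<lambda>z. z))"
    by (subst nn_integral_distr) auto
  also have "\<dots> = emeasure (distr (lebesgue_on S) borel (\<lambda>z. z)) B"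
    by (subst nn_integral_indicator) auto
  finally show "emeasure (distr (lebesgue_on S) borel (\<lambda>z. \<zeta> * z)) B =
     emeasure (distr (lebesgue_on S) borel (\<lambda>z. z)) B" .
qed simp

lemma integral_rotate_on:
  fixes h :: "complex \<Rightarrow> complex" and S :: "complex set"
  assumes h: "h \<in> borel_measurable borel" and S: "S \<in> sets borel"
    and z1: "norm \<zeta> = 1" and inv: "\<And>z. \<zeta> * z \<in> S \<longleftrightarrow> z \<in> S"
  shows "(LINT z|lebesgue_on S. h (\<zeta> * z)) = (LINT z|lebesgue_on S. h z)"
proof -
  have [measurable]: "(\<lambda>z. z) \<in> borel_measurable (lebesgue_on S)" "(\<lambda>z. \<zeta> * z) \<in> borel_measurable (lebesgue_on S)"
    by (intro borel_measurable_lebesgue_on, measurable)+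
  have "(LINT z|lebesgue_on S. h (\<zeta> * z)) = (LINT z|distr (lebesgue_on S) borel (\<lambda>z. \<zeta> * z). h z)"
    by (subst integral_distr) (use h in auto)
  also have "\<dots> = (LINT z|distr (lebesgue_on S) borel (\<lambda>z. z). h z)"
    by (simp only: distr_rotate_on[OF S z1 inv])
  also have "\<dots> = (LINT z|lebesgue_on S. h z)"
    by (subst integral_distr) (use h in auto)
  finally show ?thesis .
qed

section \<open>Polar coordinates on the annulus\<close>

lemma open_annulus: "open (annulus R)"
proof -
  have "annulus R = {z. R < norm z} \<inter> {z. norm z < 1}" by (auto simp: annulus_def)
  moreover have "open {z::complex. R < norm z}" "open {z::complex. norm z < 1}"
    by (intro open_Collect_less continuous_intros)+
  ultimately show ?thesis by auto
qed

lemma annulus_borel [measurable]: "annulus R \<in> sets borel"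
  by (rule borel_open[OF open_annulus])

text \<open>The image of area measure on the annulus under \<open>z \<mapsto> |z|\<close> has density \<open>2 \<pi> r\<close>, because both measures give
\<open>{x<..}\<close> the mass \<open>\<pi> (1 - (max R x)\<^sup>2)\<close> as long as \<open>max R x < 1\<close>, and mass \<open>0\<close> otherwise.\<close>

lemma nn_integral_radial:
  fixes H :: "real \<Rightarrow> ennreal"
  assumes R: "0 \<le> R" and H [measurable]: "H \<in> borel_measurable borel"
  shows "(\<integral>\<^sup>+z. H (norm z) \<partial>lebesgue_on (annulus R)) =
         (\<integral>\<^sup>+r. ennreal (2 * pi * r) * H r \<partial>lebesgue_on {R..1})"
proof -
  define M where "M = distr (lebesgue_on (annulus R)) borel (norm :: complex \<Rightarrow> real)"
  define N where "N = density lborel (\<lambda>r. indicator {R..1} r * ennreal (2 * pi * r))"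
  have [measurable]: "(norm :: complex \<Rightarrow> real) \<in> borel_measurable (lebesgue_on (annulus R))"
    by (rule borel_measurable_lebesgue_on) measurable
  have M: "emeasure M {x<..} = ennreal (if max R x < 1 then pi * (1 - (max R x)^2) else 0)" for x
  proof -
    define y where "y = max R x"
    have y0: "y \<ge> 0" using R by (simp add: y_def)
    have "emeasure M {x<..} = (\<integral>\<^sup>+r. indicator {x<..} r \<partial>M)"
      by (simp add: M_def)
    also have "\<dots> = (\<integral>\<^sup>+z. indicator {x<..} (norm z) \<partial>lebesgue_on (annulus R))"
      unfolding M_def by (rule nn_integral_distr) measurable
    also have "\<dots> = (\<integral>\<^sup>+z. indicator (annulus R) z * indicator {x<..} (norm z) \<partial>lborel)"
      by (rule nn_integral_lebesgue_on_borel) measurable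
    also have "\<dots> = (\<integral>\<^sup>+z. indicator (ball 0 1 - cball 0 y) z \<partial>(lborel :: complex measure))"
      by (intro nn_integral_cong) (auto simp: indicator_def annulus_def y_def)
    also have "\<dots> = emeasure lborel (ball 0 1 - cball 0 y :: complex set)"
      by simp
    also have "\<dots> = ennreal (if y < 1 then pi * (1 - y^2) else 0)"
    proof (cases "y < 1")
      case True
      have "emeasure lborel (ball 0 1 - cball 0 y :: complex set) =
          emeasure lborel (ball 0 1 :: complex set) - emeasure lborel (cball 0 y :: complex set)"
        by (rule emeasure_Diff)
           (use True y0 in \<open>auto simp: emeasure_cball\<close>)
      also have "\<dots> = ennreal (pi * (1 - y^2))"
        using y0 by (simp add: emeasure_cball emeasure_ball unit_ball_vol_2 ennreal_minus algebra_simps)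
      finally show ?thesis using True by simp
    next
      case False
      hence "(ball 0 1 - cball 0 y :: complex set) = {}" by auto
      with False show ?thesis by (simp only: emeasure_empty if_False ennreal_0)
    qed
    finally show ?thesis by (simp add: y_def)
  qed
  have N: "emeasure N {x<..} = ennreal (if max R x < 1 then pi * (1 - (max R x)^2) else 0)" for x
  proof -
    define y where "y = max R x"
    have y0: "y \<ge> 0" using R by (simp add: y_def)
    have "emeasure N {x<..} = (\<integral>\<^sup>+r. indicator {R..1} r * ennreal (2 * pi * r) * indicator {x<..} r \<partial>lborel)"
      unfolding N_def by (subst emeasure_density) auto
    also have "\<dots> = (\<integral>\<^sup>+r. ennreal (2 * pi * r) * indicator {y..1} r \<partial>lborel)"
      by (intro nn_integral_cong_AE, rule AE_mp[OF AE_lborel_singleton[of y]], intro AE_I2)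
         (auto simp: indicator_def y_def max_def split: if_splits)
    also have "\<dots> = ennreal (if y < 1 then pi * (1 - y^2) else 0)"
    proof (cases "y \<le> 1")
      case True
      have "(\<integral>\<^sup>+r. ennreal (2 * pi * r) * indicator {y..1} r \<partial>lborel) = ennreal (pi * 1^2 - pi * y^2)"
        by (rule nn_integral_FTC_Icc[where F = "\<lambda>r. pi * r^2"])
           (use True y0 in \<open>auto intro!: derivative_eq_intros\<close>)
      thus ?thesis using True by (auto simp: algebra_simps)
    qed auto
    finally show ?thesis by (simp add: y_def)
  qed
  have "M = N"
  proof (rule measure_eqI_lessThan)
    show "emeasure M {x<..} < \<infinity>" for x by (simp add: M)
  qed (simp_all add: M N, simp_all add: M_def N_def)
  have "(\<integral>\<^sup>+z. H (norm z) \<partial>lebesgue_on (annulus R)) = (\<integral>\<^sup>+r. H r \<partial>M)"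
    unfolding M_def by (subst nn_integral_distr) auto
  also have "\<dots> = (\<integral>\<^sup>+r. indicator {R..1} r * ennreal (2 * pi * r) * H r \<partial>lborel)"
    unfolding \<open>M = N\<close> N_def by (subst nn_integral_density) auto
  also have "\<dots> = (\<integral>\<^sup>+r. ennreal (2 * pi * r) * H r \<partial>lebesgue_on {R..1})"
    by (subst nn_integral_lebesgue_on_borel) (auto simp: mult.assoc)
  finally show ?thesis .
qed

lemma cis_measurable [measurable]: "cis \<in> borel_measurable borel"
  by (intro borel_measurable_continuous_onI continuous_intros)

lemma nn_integral_circle_rotate:
  fixes h :: "complex \<Rightarrow> ennreal"
  assumes [measurable]: "h \<in> borel_measurable borel" and xi: "norm \<xi> = 1"
  shows "(\<integral>\<^sup>+\<theta>. h (\<xi> * cis \<theta>) \<partial>lebesgue_on {0..2*pi}) = (\<integral>\<^sup>+\<theta>. h (cis \<theta>) \<partial>lebesgue_on {0..2*pi})"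
proof -
  define \<alpha> where "\<alpha> = Arg2pi \<xi>"
  have al: "\<alpha> \<ge> 0" "\<alpha> < 2 * pi"
    using Arg2pi[of \<xi>] by (auto simp: \<alpha>_def)
  have xi_eq: "\<xi> = cis \<alpha>"
    using Arg2pi_eq[of \<xi>] xi by (simp add: \<alpha>_def cis_conv_exp)
  define k where "k = (\<lambda>\<theta>. h (cis \<theta>))"
  have [measurable]: "k \<in> borel_measurable borel"
    unfolding k_def by measurable
  have per: "k (2 * pi + \<theta>) = k \<theta>" for \<theta>
    by (simp add: k_def flip: cis_mult)
  have half_open: "(\<integral>\<^sup>+\<theta>. u \<theta> \<partial>lebesgue_on {0..2*pi}) = (\<integral>\<^sup>+\<theta>. indicator {0..<2*pi} \<theta> * u \<theta> \<partial>lborel)"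
    if [measurable]: "u \<in> borel_measurable borel" for u :: "real \<Rightarrow> ennreal"
    by (subst nn_integral_lebesgue_on_borel, simp, simp, intro nn_integral_cong_AE,
        rule AE_mp[OF AE_lborel_singleton[of "2*pi"]], intro AE_I2) (auto simp: indicator_def)
  have "(\<integral>\<^sup>+\<theta>. h (\<xi> * cis \<theta>) \<partial>lebesgue_on {0..2*pi}) = (\<integral>\<^sup>+\<theta>. k (\<alpha> + \<theta>) \<partial>lebesgue_on {0..2*pi})"
    by (simp add: xi_eq k_def cis_mult)
  also have "\<dots> = (\<integral>\<^sup>+\<theta>. indicator {0..<2*pi} \<theta> * k (\<alpha> + \<theta>) \<partial>lborel)"
    by (rule half_open) measurable
  also have "\<dots> = (\<integral>\<^sup>+\<theta>. (\<lambda>t. indicator {\<alpha>..<\<alpha>+2*pi} t * k t) (\<alpha> + \<theta>) \<partial>lborel)"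
    by (intro nn_integral_cong) (auto simp: indicator_def)
  also have "\<dots> = (\<integral>\<^sup>+t. indicator {\<alpha>..<\<alpha>+2*pi} t * k t \<partial>lborel)"
    by (rule nn_integral_lborel_shift) measurable
  also have "\<dots> = (\<integral>\<^sup>+t. indicator {\<alpha>..<2*pi} t * k t + indicator {2*pi..<\<alpha>+2*pi} t * k t \<partial>lborel)"
    using al by (intro nn_integral_cong) (auto simp: indicator_def)
  also have "\<dots> = (\<integral>\<^sup>+t. indicator {\<alpha>..<2*pi} t * k t \<partial>lborel) + (\<integral>\<^sup>+t. indicator {2*pi..<\<alpha>+2*pi} t * k t \<partial>lborel)"
    by (rule nn_integral_add) measurable
  also have "(\<integral>\<^sup>+t. indicator {2*pi..<\<alpha>+2*pi} t * k t \<partial>lborel) =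
      (\<integral>\<^sup>+t. (\<lambda>t. indicator {2*pi..<\<alpha>+2*pi} t * k t) (2 * pi + t) \<partial>lborel)"
    by (rule nn_integral_lborel_shift[symmetric]) measurable
  also have "\<dots> = (\<integral>\<^sup>+t. indicator {0..<\<alpha>} t * k t \<partial>lborel)"
    by (intro nn_integral_cong) (auto simp: indicator_def per)
  also have "(\<integral>\<^sup>+t. indicator {\<alpha>..<2*pi} t * k t \<partial>lborel) + (\<integral>\<^sup>+t. indicator {0..<\<alpha>} t * k t \<partial>lborel) =
      (\<integral>\<^sup>+t. indicator {\<alpha>..<2*pi} t * k t + indicator {0..<\<alpha>} t * k t \<partial>lborel)"
    by (rule nn_integral_add[symmetric]) measurable
  also have "\<dots> = (\<integral>\<^sup>+t. indicator {0..<2*pi} t * k t \<partial>lborel)"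
    using al by (intro nn_integral_cong) (auto simp: indicator_def)
  also have "\<dots> = (\<integral>\<^sup>+\<theta>. k \<theta> \<partial>lebesgue_on {0..2*pi})"
    by (rule half_open[symmetric]) measurable
  finally show ?thesis by (simp add: k_def)
qed

lemma emeasure_circle: "emeasure (lebesgue_on {0..2*pi}) (space (lebesgue_on {0..2*pi})) = ennreal (2 * pi)"
  by (simp add: emeasure_restrict_space)

lemma finite_measure_circle: "finite_measure (lebesgue_on {0..2*pi})"
  by (rule finite_measure_lebesgue_on) simp

lemma bounded_annulus: "bounded (annulus R)"
  by (rule bounded_subset[OF bounded_ball[of 0 1]]) (auto simp: annulus_def)

lemma finite_measure_annulus: "finite_measure (lebesgue_on (annulus R))"
  by (rule finite_measure_lebesgue_on[OF lmeasurable_open[OF bounded_annulus open_annulus]])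

lemma annulus_rotate: "norm \<zeta> = 1 \<Longrightarrow> \<zeta> * z \<in> annulus R \<longleftrightarrow> z \<in> annulus R"
  by (simp add: annulus_def norm_mult)

lemma pair_sigma_finite_annulus_circle:
  "pair_sigma_finite (lebesgue_on (annulus R)) (lebesgue_on {0..2*pi})"
  unfolding pair_sigma_finite_def
  by (intro conjI finite_measure.axioms(1)[OF finite_measure_circle]
      finite_measure.axioms(1)[OF finite_measure_annulus])

text \<open>Averaging \<open>h\<close> over all rotations leaves its integral unchanged and replaces it by a function of \<open>|z|\<close> alone,
namely its mean over circles, to which the radial formula applies.\<close>

lemma nn_integral_polar:
  fixes h :: "complex \<Rightarrow> ennreal"
  assumes R: "0 \<le> R" and [measurable]: "h \<in> borel_measurable borel"
  shows "(\<integral>\<^sup>+z. h z \<partial>lebesgue_on (annulus R)) =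
    (\<integral>\<^sup>+r. \<integral>\<^sup>+\<theta>. ennreal r * h (rcis r \<theta>) \<partial>lebesgue_on {0..2*pi} \<partial>lebesgue_on {R..1})"
proof -
  interpret pair_sigma_finite "lebesgue_on (annulus R)" "lebesgue_on {0..2*pi}"
    by (rule pair_sigma_finite_annulus_circle)
  define G where "G = (\<lambda>r. \<integral>\<^sup>+\<theta>. h (of_real r * cis \<theta>) \<partial>lebesgue_on {0..2*pi})"
  have G_lborel: "G = (\<lambda>r. \<integral>\<^sup>+\<theta>. indicator {0..2*pi} \<theta> * h (of_real r * cis \<theta>) \<partial>lborel)"
    unfolding G_def by (intro ext nn_integral_lebesgue_on_borel) measurable
  have [measurable]: "G \<in> borel_measurable borel"
    unfolding G_lborel by measurable
  have h_pair: "(\<lambda>(z, \<theta>). h (cis \<theta> * z)) \<in> borel_measurable (lebesgue_on (annulus R) \<Otimes>\<^sub>M lebesgue_on {0..2*pi})"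
    by (rule borel_measurable_lebesgue_on_pair) measurable
  have circle: "(\<integral>\<^sup>+\<theta>. h (cis \<theta> * z) \<partial>lebesgue_on {0..2*pi}) = G (norm z)" for z
  proof (cases "z = 0")
    case False
    have "z = of_real (norm z) * sgn z"
      using False by (simp add: sgn_div_norm scaleR_conv_of_real)
    hence eq: "cis \<theta> * z = of_real (norm z) * (sgn z * cis \<theta>)" for \<theta>
      by (metis mult.assoc mult.commute)
    have "(\<integral>\<^sup>+\<theta>. h (cis \<theta> * z) \<partial>lebesgue_on {0..2*pi}) =
        (\<integral>\<^sup>+\<theta>. (\<lambda>w. h (of_real (norm z) * w)) (sgn z * cis \<theta>) \<partial>lebesgue_on {0..2*pi})"
      by (simp only: eq)
    also have "\<dots> = (\<integral>\<^sup>+\<theta>. (\<lambda>w. h (of_real (norm z) * w)) (cis \<theta>) \<partial>lebesgue_on {0..2*pi})"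
      by (rule nn_integral_circle_rotate) (use False in \<open>auto simp: norm_sgn\<close>)
    finally show ?thesis by (simp add: G_def)
  qed (simp add: G_def)
  have "ennreal (2 * pi) * (\<integral>\<^sup>+z. h z \<partial>lebesgue_on (annulus R)) =
      (\<integral>\<^sup>+\<theta>. (\<integral>\<^sup>+z. h z \<partial>lebesgue_on (annulus R)) \<partial>lebesgue_on {0..2*pi})"
    by (subst nn_integral_const) (simp only: emeasure_circle, rule mult.commute)
  also have "\<dots> = (\<integral>\<^sup>+\<theta>. \<integral>\<^sup>+z. h (cis \<theta> * z) \<partial>lebesgue_on (annulus R) \<partial>lebesgue_on {0..2*pi})"
    by (intro nn_integral_cong nn_integral_rotate_on[symmetric]) (auto simp: annulus_rotate)
  also have "\<dots> = (\<integral>\<^sup>+z. \<integral>\<^sup>+\<theta>. h (cis \<theta> * z) \<partial>lebesgue_on {0..2*pi} \<partial>lebesgue_on (annulus R))"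
    by (rule Fubini'[OF h_pair])
  also have "\<dots> = (\<integral>\<^sup>+z. G (norm z) \<partial>lebesgue_on (annulus R))"
    by (simp add: circle)
  also have "\<dots> = (\<integral>\<^sup>+r. ennreal (2 * pi * r) * G r \<partial>lebesgue_on {R..1})"
    by (rule nn_integral_radial[OF R]) measurable
  also have "\<dots> = (\<integral>\<^sup>+r. ennreal (2 * pi) * (ennreal r * G r) \<partial>lebesgue_on {R..1})"
    using R by (intro nn_integral_cong) (auto simp: ennreal_mult mult.assoc)
  also have "\<dots> = ennreal (2 * pi) * (\<integral>\<^sup>+r. ennreal r * G r \<partial>lebesgue_on {R..1})"
    by (intro nn_integral_cmult borel_measurable_lebesgue_on) measurable
  finally have "(\<integral>\<^sup>+z. h z \<partial>lebesgue_on (annulus R)) = (\<integral>\<^sup>+r. ennreal r * G r \<partial>lebesgue_on {R..1})"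
    by (simp add: ennreal_mult_cancel_left)
  also have "\<dots> = (\<integral>\<^sup>+r. \<integral>\<^sup>+\<theta>. ennreal r * h (rcis r \<theta>) \<partial>lebesgue_on {0..2*pi} \<partial>lebesgue_on {R..1})"
    unfolding G_def rcis_def by (intro nn_integral_cong nn_integral_cmult[symmetric] borel_measurable_lebesgue_on) measurable
  finally show ?thesis .
qed

lemma finite_measure_radius: "finite_measure (lebesgue_on {R..1::real})"
  by (rule finite_measure_lebesgue_on) simp

lemma pair_sigma_finite_radius_circle:
  "pair_sigma_finite (lebesgue_on {R..1::real}) (lebesgue_on {0..2*pi})"
  unfolding pair_sigma_finite_def
  by (intro conjI finite_measure.axioms(1)[OF finite_measure_circle]
      finite_measure.axioms(1)[OF finite_measure_radius])

lemma finite_measure_radius_circle: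
  "finite_measure (lebesgue_on {R..1::real} \<Otimes>\<^sub>M lebesgue_on {0..2*pi})"
  by (rule finite_measure_pair_measure[OF finite_measure_circle finite_measure_radius])

lemma rcis_measurable [measurable]: "(\<lambda>p. rcis (fst p) (snd p)) \<in> borel_measurable (borel \<Otimes>\<^sub>M borel)"
  unfolding rcis_def by measurable

text \<open>As an equality of measures the polar formula transfers to Bochner integrals.\<close>

lemma distr_polar:
  assumes R: "0 \<le> R"
  shows "distr (density (lebesgue_on {R..1} \<Otimes>\<^sub>M lebesgue_on {0..2*pi}) (\<lambda>p. ennreal (fst p))) borel
           (\<lambda>p. rcis (fst p) (snd p)) = distr (lebesgue_on (annulus R)) borel (\<lambda>z. z)"
proof (rule measure_eqI)
  let ?PM = "lebesgue_on {R..1} \<Otimes>\<^sub>M lebesgue_on {0..2*pi}"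
  interpret pair_sigma_finite "lebesgue_on {R..1}" "lebesgue_on {0..2*pi}"
    by (rule pair_sigma_finite_radius_circle)
  have rcis: "(\<lambda>p. rcis (fst p) (snd p)) \<in> borel_measurable ?PM"
    by (rule borel_measurable_lebesgue_on_pair) measurable
  have fst: "(\<lambda>p. ennreal (fst p)) \<in> borel_measurable ?PM"
    by (rule borel_measurable_lebesgue_on_pair) measurable
  have id: "(\<lambda>z. z) \<in> borel_measurable (lebesgue_on (annulus R))"
    by (rule borel_measurable_lebesgue_on) measurable
  fix B assume "B \<in> sets (distr (density ?PM (\<lambda>p. ennreal (fst p))) borel (\<lambda>p. rcis (fst p) (snd p)))"
  hence B [measurable]: "B \<in> sets borel" by simp
  have meas: "(\<lambda>p. ennreal (fst p) * indicator B (rcis (fst p) (snd p))) \<in> borel_measurable ?PM"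
    by (rule borel_measurable_lebesgue_on_pair) measurable
  have ind: "(\<lambda>p. indicator B (rcis (fst p) (snd p))) \<in> borel_measurable ?PM"
    by (rule borel_measurable_lebesgue_on_pair) measurable
  have "emeasure (distr (density ?PM (\<lambda>p. ennreal (fst p))) borel (\<lambda>p. rcis (fst p) (snd p))) B =
      (\<integral>\<^sup>+z. indicator B z \<partial>distr (density ?PM (\<lambda>p. ennreal (fst p))) borel (\<lambda>p. rcis (fst p) (snd p)))"
    by (rule nn_integral_indicator[symmetric]) simp
  also have "\<dots> = (\<integral>\<^sup>+p. indicator B (rcis (fst p) (snd p)) \<partial>density ?PM (\<lambda>p. ennreal (fst p)))"
    by (rule nn_integral_distr) (use rcis in simp_all)
  also have "\<dots> = (\<integral>\<^sup>+p. ennreal (fst p) * indicator B (rcis (fst p) (snd p)) \<partial>?PM)"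
    by (rule nn_integral_density[OF fst ind])
  also have "\<dots> = (\<integral>\<^sup>+r. \<integral>\<^sup>+\<theta>. ennreal r * indicator B (rcis r \<theta>) \<partial>lebesgue_on {0..2*pi} \<partial>lebesgue_on {R..1})"
    using M2.nn_integral_fst[OF meas] by simp
  also have "\<dots> = (\<integral>\<^sup>+z. indicator B z \<partial>lebesgue_on (annulus R))"
    by (rule nn_integral_polar[OF R, symmetric]) measurable
  also have "\<dots> = (\<integral>\<^sup>+z. indicator B z \<partial>distr (lebesgue_on (annulus R)) borel (\<lambda>z. z))"
    by (rule nn_integral_distr[OF id, symmetric]) simp
  also have "\<dots> = emeasure (distr (lebesgue_on (annulus R)) borel (\<lambda>z. z)) B"
    by (rule nn_integral_indicator) simp
  finally show "emeasure (distr (density ?PM (\<lambda>p. ennreal (fst p))) borel (\<lambda>p. rcis (fst p) (snd p))) B =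
      emeasure (distr (lebesgue_on (annulus R)) borel (\<lambda>z. z)) B" .
qed simp

text \<open>Boundedness of \<open>h\<close> makes the integrand integrable on the product space, as Fubini's theorem requires.\<close>

lemma integral_polar:
  fixes h :: "complex \<Rightarrow> complex"
  assumes R: "0 \<le> R" and h [measurable]: "h \<in> borel_measurable borel" and C: "\<And>z. norm (h z) \<le> C"
  shows "(LINT z|lebesgue_on (annulus R). h z) =
    (LINT r|lebesgue_on {R..1}. LINT \<theta>|lebesgue_on {0..2*pi}. of_real r * h (rcis r \<theta>))"
proof -
  let ?PM = "lebesgue_on {R..1} \<Otimes>\<^sub>M lebesgue_on {0..2*pi}"
  interpret pair_sigma_finite "lebesgue_on {R..1}" "lebesgue_on {0..2*pi}"
    by (rule pair_sigma_finite_radius_circle)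
  interpret PM: finite_measure ?PM by (rule finite_measure_radius_circle)
  have rcis: "(\<lambda>p. rcis (fst p) (snd p)) \<in> borel_measurable ?PM"
    by (rule borel_measurable_lebesgue_on_pair) measurable
  have fst: "fst \<in> borel_measurable ?PM"
    by (rule borel_measurable_lebesgue_on_pair) measurable
  have id: "(\<lambda>z. z) \<in> borel_measurable (lebesgue_on (annulus R))"
    by (rule borel_measurable_lebesgue_on) measurable
  have sp: "p \<in> space ?PM \<Longrightarrow> fst p \<in> {R..1}" for p
    by (auto simp: space_pair_measure)
  have meas: "(\<lambda>p. fst p *\<^sub>R h (rcis (fst p) (snd p))) \<in> borel_measurable ?PM"
    by (rule borel_measurable_lebesgue_on_pair) measurable
  have int: "integrable ?PM (\<lambda>p. fst p *\<^sub>R h (rcis (fst p) (snd p)))"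
  proof (rule PM.integrable_const_bound[where B = C])
    show "AE p in ?PM. norm (fst p *\<^sub>R h (rcis (fst p) (snd p))) \<le> C"
    proof (rule AE_I2)
      fix p assume "p \<in> space ?PM"
      hence "\<bar>fst p\<bar> \<le> 1" using sp[of p] R by auto
      thus "norm (fst p *\<^sub>R h (rcis (fst p) (snd p))) \<le> C"
        using mult_mono[of "\<bar>fst p\<bar>" 1 "norm (h (rcis (fst p) (snd p)))" C] C[of "rcis (fst p) (snd p)"] by simp
    qed
  qed (rule meas)
  have "(LINT z|lebesgue_on (annulus R). h z) = (LINT z|distr (lebesgue_on (annulus R)) borel (\<lambda>z. z). h z)"
    by (rule integral_distr[OF id h, symmetric])
  also have "\<dots> = (LINT z|distr (density ?PM (\<lambda>p. ennreal (fst p))) borel (\<lambda>p. rcis (fst p) (snd p)). h z)"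
    by (simp only: distr_polar[OF R])
  also have "\<dots> = (LINT p|density ?PM (\<lambda>p. ennreal (fst p)). h (rcis (fst p) (snd p)))"
    by (rule integral_distr[OF _ h]) (use rcis in simp)
  also have "\<dots> = (LINT p|?PM. fst p *\<^sub>R h (rcis (fst p) (snd p)))"
  proof (rule integral_density)
    show "AE p in ?PM. 0 \<le> fst p"
    proof (rule AE_I2)
      fix p assume "p \<in> space ?PM"
      thus "0 \<le> fst p" using sp[of p] R by simp
    qed
    show "fst \<in> borel_measurable ?PM" by (rule fst)
    show "(\<lambda>p. h (rcis (fst p) (snd p))) \<in> borel_measurable ?PM"
      by (rule measurable_compose[OF rcis h])
  qed
  also have "\<dots> = (LINT r|lebesgue_on {R..1}. LINT \<theta>|lebesgue_on {0..2*pi}. r *\<^sub>R h (rcis r \<theta>))"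
    using integral_fst'[OF int] by simp
  finally show ?thesis by (simp add: scaleR_conv_of_real)
qed

lemma AE_lebesgue_on_borel_null:
  fixes S :: "'a::euclidean_space set"
  assumes "AE z in lebesgue_on S. P z" and S: "S \<in> sets borel"
  obtains N where "N \<in> sets borel" "emeasure lborel N = 0" "\<And>z. z \<in> S \<Longrightarrow> z \<notin> N \<Longrightarrow> P z"
proof -
  have "AE z in lebesgue. z \<in> S \<longrightarrow> P z"
    using assms by (subst (asm) AE_restrict_space_iff) auto
  hence "AE z in lborel. z \<in> S \<longrightarrow> P z"
    by (simp add: AE_completion_iff)
  then obtain N where N: "{z \<in> space lborel. \<not> (z \<in> S \<longrightarrow> P z)} \<subseteq> N" "emeasure lborel N = 0" "N \<in> sets lborel"
    by (rule AE_E)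
  show ?thesis
    by (rule that[of N]) (use N in auto)
qed

text \<open>The polar formula is applied to the indicator of a Borel set that contains the exceptional points and the complement of
the annulus; the latter takes care of the boundary radii \<open>R\<close> and \<open>1\<close>.\<close>

lemma AE_polar:
  assumes R: "0 < R" and P: "AE z in lebesgue_on (annulus R). P z"
  shows "AE r in lebesgue_on {R..1}. AE \<theta> in lebesgue_on {0..2*pi}. rcis r \<theta> \<in> annulus R \<and> P (rcis r \<theta>)"
proof -
  let ?PM = "lebesgue_on {R..1} \<Otimes>\<^sub>M lebesgue_on {0..2*pi}"
  interpret pair_sigma_finite "lebesgue_on {R..1}" "lebesgue_on {0..2*pi}"
    by (rule pair_sigma_finite_radius_circle)
  obtain N where N [measurable]: "N \<in> sets borel" and N0: "emeasure lborel N = 0"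
    and NP: "\<And>z. z \<in> annulus R \<Longrightarrow> z \<notin> N \<Longrightarrow> P z"
    using AE_lebesgue_on_borel_null[OF P annulus_borel] by metis
  define B where "B = N \<union> - annulus R"
  have [measurable]: "B \<in> sets borel"
    unfolding B_def by (intro sets.Un N borel_comp annulus_borel)
  have "(\<integral>\<^sup>+z. indicator B z \<partial>lebesgue_on (annulus R)) = (\<integral>\<^sup>+z. indicator (annulus R) z * indicator B z \<partial>lborel)"
    by (rule nn_integral_lebesgue_on_borel) measurable
  also have "\<dots> \<le> (\<integral>\<^sup>+z. indicator N z \<partial>lborel)"
    by (intro nn_integral_mono) (auto simp: B_def indicator_def)
  finally have "(\<integral>\<^sup>+z. indicator B z \<partial>lebesgue_on (annulus R)) = 0"
    by (simp add: N0)
  moreover have "(\<integral>\<^sup>+z. indicator B z \<partial>lebesgue_on (annulus R)) =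
     (\<integral>\<^sup>+r. \<integral>\<^sup>+\<theta>. ennreal r * indicator B (rcis r \<theta>) \<partial>lebesgue_on {0..2*pi} \<partial>lebesgue_on {R..1})"
    by (rule nn_integral_polar) (use R in auto)
  ultimately have 0: "(\<integral>\<^sup>+r. \<integral>\<^sup>+\<theta>. ennreal r * indicator B (rcis r \<theta>) \<partial>lebesgue_on {0..2*pi} \<partial>lebesgue_on {R..1}) = 0"
    by simp
  have meas: "(\<lambda>p. ennreal (fst p) * indicator B (rcis (fst p) (snd p))) \<in> borel_measurable ?PM"
    by (rule borel_measurable_lebesgue_on_pair) measurable
  have "AE r in lebesgue_on {R..1}. (\<integral>\<^sup>+\<theta>. ennreal r * indicator B (rcis r \<theta>) \<partial>lebesgue_on {0..2*pi}) = 0"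
    using 0 M2.borel_measurable_nn_integral_fst[OF meas] by (subst (asm) nn_integral_0_iff_AE) auto
  moreover have "AE r in lebesgue_on {R..1}. r \<in> space (lebesgue_on {R..1})"
    by (rule AE_space)
  ultimately show ?thesis
  proof eventually_elim
    case (elim r)
    have r0: "r > 0" using elim R by simp
    have m: "(\<lambda>\<theta>. ennreal r * indicator B (rcis r \<theta>)) \<in> borel_measurable (lebesgue_on {0..2*pi})"
      unfolding rcis_def by (rule borel_measurable_lebesgue_on) measurable
    have "AE \<theta> in lebesgue_on {0..2*pi}. ennreal r * indicator B (rcis r \<theta>) = 0"
      using elim nn_integral_0_iff_AE[OF m] by simp
    thus ?case
      by eventually_elim (use r0 NP in \<open>auto simp: B_def indicator_def split: if_splits\<close>)
  qed
qed

section \<open>Bounded symbols and their moments\<close>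

lemma lebesgue_on_measurable_cong_AE:
  fixes u v :: "'a::euclidean_space \<Rightarrow> 'b::euclidean_space"
  assumes u: "u \<in> borel_measurable (lebesgue_on S)" and S: "S \<in> sets lebesgue"
    and AE: "AE x in lebesgue_on S. u x = v x"
  shows "v \<in> borel_measurable (lebesgue_on S)"
proof -
  have "(\<lambda>x. if x \<in> S then v x else 0) \<in> borel_measurable lebesgue"
  proof (rule borel_measurable_AE)
    show "(\<lambda>x. if x \<in> S then u x else 0) \<in> borel_measurable lebesgue"
      using u S by (simp add: borel_measurable_if)
    have "AE x in lebesgue. x \<in> S \<longrightarrow> u x = v x"
      using AE S by (subst (asm) AE_restrict_space_iff) auto
    thus "AE x in lebesgue. (if x \<in> S then u x else 0) = (if x \<in> S then v x else 0)"
      by eventually_elim auto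
  qed
  thus ?thesis using S by (simp add: borel_measurable_if)
qed

text \<open>The representative is truncated so that the essential bound holds everywhere.\<close>

lemma Linf_borel_representative:
  assumes "h \<in> Linf_annulus R"
  obtains h' C where "h' \<in> borel_measurable borel" "\<And>z. norm (h' z) \<le> C"
    "\<And>z. z \<notin> annulus R \<Longrightarrow> h' z = 0" "AE z in lebesgue_on (annulus R). h z = h' z"
proof -
  obtain C where C: "AE z in lebesgue_on (annulus R). norm (h z) \<le> C"
    and h: "h \<in> borel_measurable (lebesgue_on (annulus R))"
    using assms by (auto simp: Linf_annulus_def)
  define h0 where "h0 = (\<lambda>z. if z \<in> annulus R then h z else 0)"
  have h0: "h0 \<in> borel_measurable lebesgue"
    unfolding h0_def using h by (subst borel_measurable_if) auto
  have "(\<lambda>z. Re (h0 z)) \<in> borel_measurable lebesgue" "(\<lambda>z. Im (h0 z)) \<in> borel_measurable lebesgue"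
    using measurable_compose[OF h0, of Re borel] measurable_compose[OF h0, of Im borel] by simp_all
  from this[THEN completion_ex_borel_measurable_real]
  obtain a b where [measurable]: "a \<in> borel_measurable borel" "b \<in> borel_measurable borel"
    and ab: "AE z in lborel. Re (h0 z) = a z" "AE z in lborel. Im (h0 z) = b z"
    by auto
  define h1 where "h1 = (\<lambda>z. of_real (a z) + \<i> * of_real (b z))"
  have [measurable]: "h1 \<in> borel_measurable borel"
    unfolding h1_def by measurable
  define h' where "h' = (\<lambda>z. if z \<in> annulus R \<and> norm (h1 z) \<le> C then h1 z else 0)"
  have m: "h' \<in> borel_measurable borel"
    unfolding h'_def by measurable
  have b: "norm (h' z) \<le> max C 0" for z
    unfolding h'_def by auto
  have "AE z in lborel. h0 z = h1 z"
    using ab by eventually_elim (auto simp: h1_def complex_eq_iff)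
  hence "AE z in lebesgue. h0 z = h1 z"
    by (simp add: AE_completion_iff AE_completion)
  hence "AE z in lebesgue_on (annulus R). h0 z = h1 z"
    by (subst AE_restrict_space_iff) auto
  moreover have "AE z in lebesgue_on (annulus R). z \<in> space (lebesgue_on (annulus R))"
    by (rule AE_space)
  ultimately have "AE z in lebesgue_on (annulus R). h z = h' z"
    using C by eventually_elim (auto simp: h'_def h0_def)
  from that[OF m b _ this] show ?thesis by (auto simp: h'_def)
qed

lemma powi_measurable [measurable]: "(\<lambda>z::complex. z powi n) \<in> borel_measurable borel"
  unfolding power_int_def by (cases "n \<ge> 0") simp_all

lemma cnj_measurable [measurable]: "cnj \<in> borel_measurable borel"
  by (intro borel_measurable_continuous_onI continuous_intros)

lemma powi_le_on_radius:
  fixes x :: real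
  assumes "0 < R" "R \<le> x" "x \<le> 1"
  shows "x powi n \<le> 1 + R powi n"
proof (cases "n \<ge> 0")
  case True
  have "x powi n \<le> 1 powi n"
    using assms True by (intro power_int_mono) auto
  thus ?thesis using assms by (simp add: add_increasing2)
next
  case False
  have "x powi n \<le> R powi n"
    using assms False by (intro power_int_antimono) auto
  thus ?thesis by simp
qed

text \<open>For \<open>h = f\<close> this is \<open>2 \<pi>\<close> times the matrix entry \<open>\<langle>T\<^sub>f z\<^sup>a, z\<^sup>b\<rangle>\<close> of the Toeplitz operator.\<close>

definition moment :: "real \<Rightarrow> (complex \<Rightarrow> complex) \<Rightarrow> int \<Rightarrow> int \<Rightarrow> complex" where
  "moment R h a b = (LINT z|lebesgue_on (annulus R). h z * (z powi a * cnj z powi b))"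

lemma rcis_powi: "rcis r \<theta> powi n = of_real (r powi n) * cis (of_int n * \<theta>)"
  by (simp add: rcis_def power_int_mult_distrib cis_power_int)

lemma rcis_powi_cnj_powi:
  assumes "r > 0"
  shows "rcis r \<theta> powi j * cnj (rcis r \<theta>) powi (j + k) = of_real (r powi (2 * j + k)) * cis (- of_int k * \<theta>)"
proof -
  have "rcis r \<theta> powi j * cnj (rcis r \<theta>) powi (j + k) =
      of_real (r powi j * r powi (j + k)) * (cis (of_int j * \<theta>) * cis (- (of_int (j + k) * \<theta>)))"
    unfolding complex_cnj_power_int[symmetric] rcis_powi by (simp add: cis_cnj)
  also have "r powi j * r powi (j + k) = r powi (2 * j + k)"
    using assms by (subst power_int_add[symmetric]) (auto simp: algebra_simps)
  also have "cis (of_int j * \<theta>) * cis (- (of_int (j + k) * \<theta>)) = cis (- of_int k * \<theta>)"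
    by (subst cis_mult) (simp add: algebra_simps)
  finally show ?thesis .
qed

text \<open>On the circle of radius \<open>r\<close> the product \<open>z\<^sup>j cnj(z)\<^bsup>j+k\<^esup>\<close> equals \<open>r\<^bsup>2j+k\<^esup> e\<^bsup>-ik\<theta>\<^esup>\<close>, and the
area element contributes one more factor \<open>r\<close>.\<close>

lemma moment_polar:
  assumes R: "0 < R" and h: "h \<in> Linf_annulus R"
  shows "moment R h j (j + k) =
    2 * pi * (LINT r|lebesgue_on {R..1}. polar_coeff h k r * of_real (r powi (2 * j + k + 1)))"
proof -
  obtain h' C where h' [measurable]: "h' \<in> borel_measurable borel" and C: "\<And>z. norm (h' z) \<le> C"
    and off: "\<And>z. z \<notin> annulus R \<Longrightarrow> h' z = 0" and AE: "AE z in lebesgue_on (annulus R). h z = h' z"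
    using Linf_borel_representative[OF h] by metis
  have h_meas: "h \<in> borel_measurable (lebesgue_on (annulus R))"
    using h by (simp add: Linf_annulus_def)
  define G where "G = (\<lambda>z. z powi j * cnj z powi (j + k))"
  have G [measurable]: "G \<in> borel_measurable borel"
    unfolding G_def by measurable
  have C0: "C \<ge> 0" using C[of 0] norm_ge_zero order_trans by blast
  have bd: "norm (h' z * G z) \<le> C * ((1 + R powi j) * (1 + R powi (j + k)))" for z
  proof (cases "z \<in> annulus R")
    case True
    hence z: "R \<le> norm z" "norm z \<le> 1" by (auto simp: annulus_def)
    show ?thesis
      unfolding norm_mult G_def norm_power_int complex_mod_cnj
      using R z C0 by (intro mult_mono C powi_le_on_radius mult_nonneg_nonneg) auto
  next
    case False
    thus ?thesis using C0 R off by (simp add: add_nonneg_nonneg)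
  qed
  have "moment R h j (j + k) = (LINT z|lebesgue_on (annulus R). h z * G z)"
    by (simp only: moment_def G_def)
  also have "\<dots> = (LINT z|lebesgue_on (annulus R). h' z * G z)"
  proof (rule integral_cong_AE)
    show "(\<lambda>z. h z * G z) \<in> borel_measurable (lebesgue_on (annulus R))"
      by (intro borel_measurable_times h_meas borel_measurable_lebesgue_on G)
    show "(\<lambda>z. h' z * G z) \<in> borel_measurable (lebesgue_on (annulus R))"
      by (intro borel_measurable_times borel_measurable_lebesgue_on G h')
    show "AE z in lebesgue_on (annulus R). h z * G z = h' z * G z"
      using AE by eventually_elim simp
  qed
  also have "\<dots> = (LINT r|lebesgue_on {R..1}. LINT \<theta>|lebesgue_on {0..2*pi}. of_real r * (h' (rcis r \<theta>) * G (rcis r \<theta>)))"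
    by (rule integral_polar[OF _ _ bd]) (use R in auto)
  also have "\<dots> = (LINT r|lebesgue_on {R..1}. 2 * pi * (polar_coeff h k r * of_real (r powi (2 * j + k + 1))))"
  proof -
    have meas: "(\<lambda>p. of_real (fst p) * (h' (rcis (fst p) (snd p)) * G (rcis (fst p) (snd p))))
        \<in> borel_measurable (lebesgue_on {R..1} \<Otimes>\<^sub>M lebesgue_on {0..2*pi})"
      by (rule borel_measurable_lebesgue_on_pair) measurable
    interpret N: sigma_finite_measure "lebesgue_on {0..2*pi}"
      by (rule finite_measure.axioms(1)[OF finite_measure_circle])
    have m1: "(\<lambda>r. LINT \<theta>|lebesgue_on {0..2*pi}. of_real r * (h' (rcis r \<theta>) * G (rcis r \<theta>)))
        \<in> borel_measurable (lebesgue_on {R..1})"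
      using N.borel_measurable_lebesgue_integral[of "\<lambda>r \<theta>. of_real r * (h' (rcis r \<theta>) * G (rcis r \<theta>))"] meas
      by (simp add: case_prod_beta)
    have "AE r in lebesgue_on {R..1}. AE \<theta> in lebesgue_on {0..2*pi}.
        rcis r \<theta> \<in> annulus R \<and> h (rcis r \<theta>) = h' (rcis r \<theta>)"
      by (rule AE_polar[OF R AE])
    moreover have "AE r in lebesgue_on {R..1}. r \<in> space (lebesgue_on {R..1})"
      by (rule AE_space)
    ultimately have ae: "AE r in lebesgue_on {R..1}.
       (LINT \<theta>|lebesgue_on {0..2*pi}. of_real r * (h' (rcis r \<theta>) * G (rcis r \<theta>))) =
       2 * pi * (polar_coeff h k r * of_real (r powi (2 * j + k + 1)))"
    proof eventually_elim
      case (elim r)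
      hence r: "r > 0" using R by simp
      have ae: "AE \<theta> in lebesgue_on {0..2*pi}. h' (rcis r \<theta>) = h (rcis r \<theta>)"
        using elim(1) by eventually_elim simp
      have m1: "(\<lambda>\<theta>. h' (rcis r \<theta>)) \<in> borel_measurable (lebesgue_on {0..2*pi})"
        unfolding rcis_def by (rule borel_measurable_lebesgue_on) measurable
      have m2: "(\<lambda>\<theta>. h (rcis r \<theta>)) \<in> borel_measurable (lebesgue_on {0..2*pi})"
        by (rule lebesgue_on_measurable_cong_AE[OF m1 _ ae]) simp
      have m3: "(\<lambda>\<theta>. cis (- of_int k * \<theta>)) \<in> borel_measurable (lebesgue_on {0..2*pi})"
        by (rule borel_measurable_lebesgue_on) measurable
      have "(LINT \<theta>|lebesgue_on {0..2*pi}. of_real r * (h' (rcis r \<theta>) * G (rcis r \<theta>))) =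
          (LINT \<theta>|lebesgue_on {0..2*pi}. of_real (r powi (2 * j + k + 1)) * (h' (rcis r \<theta>) * cis (- of_int k * \<theta>)))"
        unfolding G_def rcis_powi_cnj_powi[OF r]
        using r by (intro Bochner_Integration.integral_cong) (auto simp: power_int_add)
      also have "\<dots> = of_real (r powi (2 * j + k + 1)) * (LINT \<theta>|lebesgue_on {0..2*pi}. h' (rcis r \<theta>) * cis (- of_int k * \<theta>))"
        by simp
      also have "(LINT \<theta>|lebesgue_on {0..2*pi}. h' (rcis r \<theta>) * cis (- of_int k * \<theta>)) =
          (LINT \<theta>|lebesgue_on {0..2*pi}. h (rcis r \<theta>) * cis (- of_int k * \<theta>))"
        by (rule integral_cong_AE[OF borel_measurable_times[OF m1 m3] borel_measurable_times[OF m2 m3]])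
           (use ae in eventually_elim, simp)
      also have "\<dots> = 2 * pi * polar_coeff h k r"
        by (simp add: polar_coeff_def)
      finally show ?case by (simp add: mult_ac)
    qed
    show ?thesis
      by (rule integral_cong_AE[OF m1 lebesgue_on_measurable_cong_AE[OF m1 _ ae] ae]) simp
  qed
  finally show ?thesis by simp
qed

lemma moment_eq_0_polar:
  assumes R: "0 < R" and h: "h \<in> Linf_annulus R"
    and 0: "AE r in lebesgue_on {R..1}. polar_coeff h k r = 0"
  shows "moment R h j (j + k) = 0"
proof -
  have "(LINT r|lebesgue_on {R..1}. polar_coeff h k r * of_real (r powi (2 * j + k + 1))) = 0"
    by (rule integral_eq_zero_AE) (use 0 in eventually_elim, simp)
  thus ?thesis by (simp add: moment_polar[OF R h])
qed

lemma moment_eq_mellin: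
  assumes R: "0 < R" and h: "h \<in> Linf_annulus R"
  shows "moment R h j (j + k) = 2 * pi * mellin R (polar_coeff h k) (of_int (2 * j + k + 2))"
proof -
  have "polar_coeff h k r * of_real r powr (of_int (2 * j + k + 2) - 1) =
      polar_coeff h k r * of_real (r powi (2 * j + k + 1))" if "r \<in> space (lebesgue_on {R..1})" for r
  proof -
    have "r > 0" using that R by simp
    have "of_real r powr (of_int (2 * j + k + 2) - 1 :: complex) = of_real r powr (of_int (2 * j + k + 1))"
      by (simp add: algebra_simps)
    also have "\<dots> = of_real r powi (2 * j + k + 1)"
      using \<open>r > 0\<close> by (subst complex_powr_of_int) auto
    finally show ?thesis by simp
  qed
  hence "mellin R (polar_coeff h k) (of_int (2 * j + k + 2)) =
      (LINT r|lebesgue_on {R..1}. polar_coeff h k r * of_real (r powi (2 * j + k + 1)))"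
    unfolding mellin_def by (intro Bochner_Integration.integral_cong refl)
  thus ?thesis by (simp only: moment_polar[OF R h])
qed

section \<open>Circle means of holomorphic functions\<close>

lemma integrable_circle:
  fixes u :: "real \<Rightarrow> complex"
  shows "continuous_on {0..2*pi} u \<Longrightarrow> integrable (lebesgue_on {0..2*pi}) u"
  by (rule continuous_imp_integrable_real)

text \<open>Differentiation under the integral gives \<open>\<integral> e\<^bsup>i\<theta>\<^esup> v'(e\<^bsup>i\<theta>\<^esup> z) d\<theta>\<close>.  For \<open>z \<noteq> 0\<close> the integrand is
\<open>1 / (i z)\<close> times the \<open>\<theta>\<close>-derivative of the periodic function \<open>v(e\<^bsup>i\<theta>\<^esup> z)\<close>; for \<open>z = 0\<close> it is a multiple of
\<open>e\<^bsup>i\<theta>\<^esup>\<close>.\<close>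

lemma circle_mean_has_derivative_0:
  assumes S: "open S" and rot: "\<And>\<zeta> z. norm \<zeta> = 1 \<Longrightarrow> z \<in> S \<Longrightarrow> \<zeta> * z \<in> S"
    and v: "v holomorphic_on S" and z0: "z0 \<in> S"
  shows "((\<lambda>z. integral (cbox 0 (2*pi)) (\<lambda>\<theta>. v (cis \<theta> * z))) has_field_derivative 0) (at z0)"
proof -
  have rot': "z \<in> S \<Longrightarrow> cis \<theta> * z \<in> S" for z \<theta>
    by (rule rot) auto
  have dv: "(v has_field_derivative deriv v z) (at z)" if "z \<in> S" for z
    using holomorphic_derivI[OF v S that] .
  have dcont: "continuous_on S (deriv v)"
    using holomorphic_deriv[OF v S] holomorphic_on_imp_continuous_on by blast
  have vcont: "continuous_on S v"
    using v holomorphic_on_imp_continuous_on by blast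
  obtain e where e: "e > 0" "ball z0 e \<subseteq> S"
    using S z0 open_contains_ball by blast
  have "((\<lambda>z. integral (cbox 0 (2*pi)) (\<lambda>\<theta>. v (cis \<theta> * z))) has_field_derivative
      integral (cbox 0 (2*pi)) (\<lambda>\<theta>. cis \<theta> * deriv v (cis \<theta> * z0))) (at z0 within ball z0 e)"
  proof (rule leibniz_rule_field_derivative)
    fix z \<theta> assume z: "z \<in> ball z0 e"
    hence "cis \<theta> * z \<in> S" using e rot' by auto
    from DERIV_chain2[where f = v and g = "\<lambda>z. cis \<theta> * z" and x = z and s = UNIV and Db = "cis \<theta>", OF dv[OF this]]
    have "((\<lambda>z. v (cis \<theta> * z)) has_field_derivative deriv v (cis \<theta> * z) * cis \<theta>) (at z)"
      by (auto intro!: derivative_eq_intros)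
    thus "((\<lambda>z. v (cis \<theta> * z)) has_field_derivative cis \<theta> * deriv v (cis \<theta> * z)) (at z within ball z0 e)"
      by (simp add: mult.commute has_field_derivative_at_within)
  next
    fix z assume z: "z \<in> ball z0 e"
    show "(\<lambda>\<theta>. v (cis \<theta> * z)) integrable_on cbox 0 (2*pi)"
      by (rule integrable_continuous, rule continuous_on_compose2[OF vcont])
         (use z e rot' in \<open>auto intro!: continuous_intros\<close>)
  next
    have "continuous_on (ball z0 e \<times> cbox 0 (2*pi)) (\<lambda>p. cis (snd p) * deriv v (cis (snd p) * fst p))"
      by (intro continuous_intros continuous_on_compose2[OF dcont]) (use e rot' in auto)
    thus "continuous_on (ball z0 e \<times> cbox 0 (2*pi)) (\<lambda>(z, \<theta>). cis \<theta> * deriv v (cis \<theta> * z))"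
      by (simp add: case_prod_beta)
  qed (use e in auto)
  hence der: "((\<lambda>z. integral (cbox 0 (2*pi)) (\<lambda>\<theta>. v (cis \<theta> * z))) has_field_derivative
      integral (cbox 0 (2*pi)) (\<lambda>\<theta>. cis \<theta> * deriv v (cis \<theta> * z0))) (at z0)"
    by (subst (asm) at_within_open) (use e in auto)
  have dcis: "(cis has_vector_derivative (\<i> * cis \<theta>)) (at \<theta> within T)" for \<theta> T
  proof -
    have "((\<lambda>w. exp (\<i> * w)) has_field_derivative \<i> * cis \<theta>) (at (of_real \<theta>))"
      by (auto intro!: derivative_eq_intros simp: cis_conv_exp mult_ac)
    moreover have "cis = (\<lambda>x. exp (\<i> * of_real x))"
      by (simp add: fun_eq_iff cis_conv_exp)
    ultimately show ?thesis
      using has_vector_derivative_real_field[of "\<lambda>w. exp (\<i> * w)" "\<i> * cis \<theta>" \<theta> T] by simp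
  qed
  have "((\<lambda>\<theta>. \<i> * cis \<theta>) has_integral cis (2*pi) - cis 0) {0..2*pi}"
    by (intro fundamental_theorem_of_calculus dcis) simp
  hence "integral {0..2*pi} (\<lambda>\<theta>. \<i> * cis \<theta>) = cis (2*pi) - cis 0"
    by (rule integral_unique)
  also have "\<dots> = 0" by simp
  finally have cis0: "integral {0..2*pi} (\<lambda>\<theta>. \<i> * cis \<theta>) = 0" .
  have "integral {0..2*pi} (\<lambda>\<theta>. cis \<theta> * deriv v (cis \<theta> * z0)) = 0"
  proof (cases "z0 = 0")
    case True
    have "integral {0..2*pi} (\<lambda>\<theta>. cis \<theta> * deriv v (cis \<theta> * z0)) = integral {0..2*pi} (\<lambda>\<theta>. (\<i> * cis \<theta>) * (deriv v 0 / \<i>))"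
      by (rule Henstock_Kurzweil_Integration.integral_cong) (simp add: True field_simps)
    also have "\<dots> = integral {0..2*pi} (\<lambda>\<theta>. \<i> * cis \<theta>) * (deriv v 0 / \<i>)"
      by (rule integral_mult_left)
    finally show ?thesis by (simp only: cis0 mult_zero_left)
  next
    case False
    have "((\<lambda>\<theta>. v (cis \<theta> * z0)) has_vector_derivative (\<i> * z0) * (cis \<theta> * deriv v (cis \<theta> * z0))) (at \<theta> within T)" for \<theta> T
    proof -
      have "((\<lambda>\<theta>. cis \<theta> * z0) has_vector_derivative \<i> * cis \<theta> * z0) (at \<theta> within T)"
        using has_vector_derivative_mult_left[OF dcis] by simp
      from field_vector_diff_chain_within[OF this, of v "deriv v (cis \<theta> * z0)"] dv[OF rot'[OF z0]]
      show ?thesis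
        by (simp add: o_def mult_ac has_field_derivative_at_within)
    qed
    hence "((\<lambda>\<theta>. (\<i> * z0) * (cis \<theta> * deriv v (cis \<theta> * z0))) has_integral (v (cis (2*pi) * z0) - v (cis 0 * z0))) {0..2*pi}"
      by (intro fundamental_theorem_of_calculus) auto
    from integral_unique[OF this] have "integral {0..2*pi} (\<lambda>\<theta>. (\<i> * z0) * (cis \<theta> * deriv v (cis \<theta> * z0))) = 0"
      by (simp del: integral_mult_right)
    hence "(\<i> * z0) * integral {0..2*pi} (\<lambda>\<theta>. cis \<theta> * deriv v (cis \<theta> * z0)) = 0"
      by (simp only: integral_mult_right)
    thus ?thesis using False by simp
  qed
  thus ?thesis using der by simp
qed

text \<open>On a disc this is the mean value property.  On the annulus, applied to \<open>z\<^bsup>-k\<^esup>\<close> times a function, it says that the Laurent coefficients of that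
function do not depend on the circle on which they are computed.\<close>

lemma circle_mean_constant:
  assumes S: "open S" "connected S" and rot: "\<And>\<zeta> z. norm \<zeta> = 1 \<Longrightarrow> z \<in> S \<Longrightarrow> \<zeta> * z \<in> S"
    and v: "v holomorphic_on S"
  obtains c where "\<And>z. z \<in> S \<Longrightarrow> (LINT \<theta>|lebesgue_on {0..2*pi}. v (cis \<theta> * z)) = c"
proof -
  have "(\<lambda>z. integral (cbox 0 (2*pi)) (\<lambda>\<theta>. v (cis \<theta> * z))) constant_on S"
    by (rule has_field_derivative_0_imp_constant_on)
       (use circle_mean_has_derivative_0[OF S(1) rot v] S in auto)
  then obtain c where c: "\<And>z. z \<in> S \<Longrightarrow> integral {0..2*pi} (\<lambda>\<theta>. v (cis \<theta> * z)) = c"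
    by (auto simp: constant_on_def)
  have "(LINT \<theta>|lebesgue_on {0..2*pi}. v (cis \<theta> * z)) = c" if "z \<in> S" for z
  proof -
    have "continuous_on {0..2*pi} (\<lambda>\<theta>. v (cis \<theta> * z))"
      by (rule continuous_on_compose2[OF holomorphic_on_imp_continuous_on[OF v]])
         (use that rot in \<open>auto intro!: continuous_intros\<close>)
    from lebesgue_integral_eq_integral[OF integrable_circle[OF this]] show ?thesis
      using c[OF that] by simp
  qed
  thus ?thesis by (rule that)
qed

lemma connected_annulus_complex: "connected (annulus R)"
  using connected_annulus(1)[of R "0::complex" 1] by (simp add: annulus_def)

text \<open>The value at the centre of a disc is at most the mean of \<open>|F|\<close> over each concentric circle.  Integrating this over
the disc and using rotation invariance turns circle means into the area mean.\<close>

lemma holomorphic_mean_value_bound: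
  assumes F: "F holomorphic_on annulus R" and B: "ball z \<rho> \<subseteq> annulus R" and rho: "\<rho> > 0"
  shows "ennreal (norm (F z) * (pi * \<rho>^2)) \<le> (\<integral>\<^sup>+w. ennreal (norm (F w)) \<partial>lebesgue_on (annulus R))"
proof -
  let ?B = "ball (0::complex) \<rho>"
  define k where "k = (\<lambda>w. ennreal (norm (indicator (annulus R) w *\<^sub>R F w)))"
  have [measurable]: "(\<lambda>w. indicator (annulus R) w *\<^sub>R F w) \<in> borel_measurable borel"
    by (rule borel_measurable_continuous_on_indicator[OF annulus_borel holomorphic_on_imp_continuous_on[OF F]])
  have k [measurable]: "k \<in> borel_measurable borel"
    unfolding k_def by measurable
  interpret pair_sigma_finite "lebesgue_on ?B" "lebesgue_on {0..2*pi}"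
    unfolding pair_sigma_finite_def
    by (intro conjI finite_measure.axioms(1)[OF finite_measure_circle]
        finite_measure.axioms(1)[OF finite_measure_lebesgue_on]) simp
  have inA: "z + w \<in> annulus R" if "w \<in> ?B" for w
    using that B by (auto simp: subset_iff dist_norm)
  have hol: "(\<lambda>w. F (z + w)) holomorphic_on ?B"
    by (rule holomorphic_on_compose_gen[of "\<lambda>w. z + w" _ F "annulus R", unfolded o_def])
       (use F B in \<open>auto intro!: holomorphic_intros simp: subset_iff\<close>)
  obtain c where c: "\<And>w. w \<in> ?B \<Longrightarrow> (LINT \<theta>|lebesgue_on {0..2*pi}. F (z + cis \<theta> * w)) = c"
    using circle_mean_constant[of ?B "\<lambda>w. F (z + w)"] hol by (auto simp: norm_mult)
  have c_eq: "c = of_real (2 * pi) * F z"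
    using c[of 0] rho by (simp add: measure_restrict_space scaleR_conv_of_real)
  have mean: "ennreal (2 * pi * norm (F z)) \<le> (\<integral>\<^sup>+\<theta>. k (z + cis \<theta> * w) \<partial>lebesgue_on {0..2*pi})"
    if w: "w \<in> ?B" for w
  proof -
    have w': "cis \<theta> * w \<in> ?B" for \<theta> using w by (simp add: norm_mult)
    have "continuous_on {0..2*pi} (\<lambda>\<theta>. F (z + cis \<theta> * w))"
      by (rule continuous_on_compose2[OF holomorphic_on_imp_continuous_on[OF F]])
         (use w' inA in \<open>auto intro!: continuous_intros\<close>)
    from integral_norm_bound_ennreal[OF integrable_circle[OF this]]
    have "ennreal (norm c) \<le> (\<integral>\<^sup>+\<theta>. norm (F (z + cis \<theta> * w)) \<partial>lebesgue_on {0..2*pi})"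
      unfolding c[OF w] .
    also have "\<dots> = (\<integral>\<^sup>+\<theta>. k (z + cis \<theta> * w) \<partial>lebesgue_on {0..2*pi})"
      by (intro nn_integral_cong) (simp add: k_def inA[OF w'])
    finally show ?thesis by (simp add: c_eq norm_mult)
  qed
  have pair: "(\<lambda>(w, \<theta>). k (z + cis \<theta> * w)) \<in> borel_measurable (lebesgue_on ?B \<Otimes>\<^sub>M lebesgue_on {0..2*pi})"
    by (rule borel_measurable_lebesgue_on_pair) measurable
  have eB: "emeasure (lebesgue_on ?B) (space (lebesgue_on ?B)) = ennreal (pi * \<rho>^2)"
    using rho by (simp add: emeasure_restrict_space emeasure_ball unit_ball_vol_2)
  have "ennreal (2 * pi) * ennreal (norm (F z) * (pi * \<rho>^2)) = ennreal (2 * pi * norm (F z)) * ennreal (pi * \<rho>^2)"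
    by (simp add: ennreal_mult[symmetric] mult_ac)
  also have "\<dots> = (\<integral>\<^sup>+w. ennreal (2 * pi * norm (F z)) \<partial>lebesgue_on ?B)"
    by (subst nn_integral_const) (simp only: eB)
  also have "\<dots> \<le> (\<integral>\<^sup>+w. \<integral>\<^sup>+\<theta>. k (z + cis \<theta> * w) \<partial>lebesgue_on {0..2*pi} \<partial>lebesgue_on ?B)"
    by (intro nn_integral_mono mean) simp
  also have "\<dots> = (\<integral>\<^sup>+\<theta>. \<integral>\<^sup>+w. k (z + cis \<theta> * w) \<partial>lebesgue_on ?B \<partial>lebesgue_on {0..2*pi})"
    by (rule Fubini'[OF pair, symmetric])
  also have "\<dots> = (\<integral>\<^sup>+\<theta>. (\<integral>\<^sup>+w. k (z + w) \<partial>lebesgue_on ?B) \<partial>lebesgue_on {0..2*pi})"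
  proof (rule nn_integral_cong)
    fix \<theta>
    show "(\<integral>\<^sup>+w. k (z + cis \<theta> * w) \<partial>lebesgue_on ?B) = (\<integral>\<^sup>+w. k (z + w) \<partial>lebesgue_on ?B)"
      by (rule nn_integral_rotate_on[of "\<lambda>w. k (z + w)"]) (auto simp: norm_mult)
  qed
  also have "\<dots> = ennreal (2 * pi) * (\<integral>\<^sup>+w. k (z + w) \<partial>lebesgue_on ?B)"
    by (subst nn_integral_const) (simp only: emeasure_circle, rule mult.commute)
  finally have "ennreal (2 * pi) * ennreal (norm (F z) * (pi * \<rho>^2)) \<le>
      ennreal (2 * pi) * (\<integral>\<^sup>+w. k (z + w) \<partial>lebesgue_on ?B)" .
  hence "ennreal (norm (F z) * (pi * \<rho>^2)) \<le> (\<integral>\<^sup>+w. k (z + w) \<partial>lebesgue_on ?B)"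
    by (subst (asm) ennreal_mult_le_mult_iff) auto
  also have "(\<integral>\<^sup>+w. k (z + w) \<partial>lebesgue_on ?B) = (\<integral>\<^sup>+w. indicator ?B w * k (z + w) \<partial>lborel)"
    by (rule nn_integral_lebesgue_on_borel) measurable
  also have "\<dots> \<le> (\<integral>\<^sup>+w. k (z + w) \<partial>lborel)"
    by (intro nn_integral_mono) (auto simp: indicator_def)
  also have "\<dots> = (\<integral>\<^sup>+w. k w \<partial>distr lborel borel (\<lambda>w. z + w))"
    by (rule nn_integral_distr[symmetric]) measurable
  also have "\<dots> = (\<integral>\<^sup>+w. k w \<partial>lborel)"
    by (simp only: lborel_distr_plus)
  also have "\<dots> = (\<integral>\<^sup>+w. indicator (annulus R) w * k w \<partial>lborel)"
    by (intro nn_integral_cong) (auto simp: k_def indicator_def)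
  also have "\<dots> = (\<integral>\<^sup>+w. k w \<partial>lebesgue_on (annulus R))"
    by (rule nn_integral_lebesgue_on_borel[symmetric]) measurable
  also have "\<dots> = (\<integral>\<^sup>+w. ennreal (norm (F w)) \<partial>lebesgue_on (annulus R))"
    by (intro nn_integral_cong) (simp add: k_def)
  finally show ?thesis .
qed

section \<open>Square integrable functions and the Bergman projection\<close>

abbreviation \<mu> :: "real \<Rightarrow> complex measure" where
  "\<mu> R \<equiv> lebesgue_on (annulus R)"

definition sqnorm :: "real \<Rightarrow> (complex \<Rightarrow> complex) \<Rightarrow> real" where
  "sqnorm R h = (LINT z|\<mu> R. (norm (h z))\<^sup>2)"

lemma L2_annulusD:
  assumes "h \<in> L2_annulus R"
  shows "h \<in> borel_measurable (\<mu> R)" "integrable (\<mu> R) (\<lambda>z. (norm (h z))\<^sup>2)"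
  using assms by (auto simp: L2_annulus_def)

lemma L2_annulusI:
  "h \<in> borel_measurable (\<mu> R) \<Longrightarrow> integrable (\<mu> R) (\<lambda>z. (norm (h z))\<^sup>2) \<Longrightarrow> h \<in> L2_annulus R"
  by (simp add: L2_annulus_def)

lemma sqnorm_nonneg: "sqnorm R h \<ge> 0"
  unfolding sqnorm_def by (rule integral_nonneg_AE) simp

lemma L2_scale:
  assumes "h \<in> L2_annulus R"
  shows "(\<lambda>z. c * h z) \<in> L2_annulus R"
  using L2_annulusD[OF assms] by (intro L2_annulusI) (auto simp: norm_mult power_mult_distrib)

lemma L2_add:
  assumes h: "h \<in> L2_annulus R" and k: "k \<in> L2_annulus R"
  shows "(\<lambda>z. h z + k z) \<in> L2_annulus R"
proof (rule L2_annulusI)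
  show m: "(\<lambda>z. h z + k z) \<in> borel_measurable (\<mu> R)"
    by (intro borel_measurable_add L2_annulusD(1)[OF h] L2_annulusD(1)[OF k])
  show "integrable (\<mu> R) (\<lambda>z. (norm (h z + k z))\<^sup>2)"
  proof (rule Bochner_Integration.integrable_bound)
    show "integrable (\<mu> R) (\<lambda>z. 2 * (norm (h z))\<^sup>2 + 2 * (norm (k z))\<^sup>2)"
      using L2_annulusD[OF h] L2_annulusD[OF k] by simp
    show "(\<lambda>z. (norm (h z + k z))\<^sup>2) \<in> borel_measurable (\<mu> R)"
      using m by measurable
    have "(norm (a + b))\<^sup>2 \<le> 2 * (norm a)\<^sup>2 + 2 * (norm b)\<^sup>2" for a b :: complex
    proof -
      have "(norm (a + b))\<^sup>2 + (norm (a - b))\<^sup>2 = 2 * (norm a)\<^sup>2 + 2 * (norm b)\<^sup>2"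
        unfolding cmod_power2 by (simp add: power2_eq_square algebra_simps)
      thus ?thesis using zero_le_power2[of "norm (a - b)"] by linarith
    qed
    thus "AE z in \<mu> R. norm ((norm (h z + k z))\<^sup>2) \<le> norm (2 * (norm (h z))\<^sup>2 + 2 * (norm (k z))\<^sup>2)"
      by (intro AE_I2) (auto intro: order_trans)
  qed
qed

lemma L2_diff:
  assumes h: "h \<in> L2_annulus R" and k: "k \<in> L2_annulus R"
  shows "(\<lambda>z. h z - k z) \<in> L2_annulus R"
  using L2_add[OF h L2_scale[OF k, of "-1"]] by simp

lemma L2_mult_cnj_integrable:
  assumes h: "h \<in> L2_annulus R" and k: "k \<in> L2_annulus R"
  shows "integrable (\<mu> R) (\<lambda>z. h z * cnj (k z))"
proof (rule Bochner_Integration.integrable_bound)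
  show "integrable (\<mu> R) (\<lambda>z. (norm (h z))\<^sup>2 + (norm (k z))\<^sup>2)"
    using L2_annulusD[OF h] L2_annulusD[OF k] by simp
  have "(\<lambda>z. cnj (k z)) \<in> borel_measurable (\<mu> R)"
    by (rule measurable_compose[OF L2_annulusD(1)[OF k]]) measurable
  thus "(\<lambda>z. h z * cnj (k z)) \<in> borel_measurable (\<mu> R)"
    by (intro borel_measurable_times L2_annulusD(1)[OF h])
  have "x * y \<le> x\<^sup>2 + y\<^sup>2" if "x \<ge> 0" "y \<ge> 0" for x y :: real
    using sum_squares_bound[of x y] mult_nonneg_nonneg[OF that] by linarith
  thus "AE z in \<mu> R. norm (h z * cnj (k z)) \<le> norm ((norm (h z))\<^sup>2 + (norm (k z))\<^sup>2)"
    by (intro AE_I2) (auto simp: norm_mult)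
qed

lemma Linf_mult_L2:
  assumes f: "f \<in> Linf_annulus R" and h: "h \<in> L2_annulus R"
  shows "(\<lambda>z. f z * h z) \<in> L2_annulus R"
proof -
  obtain C where C: "AE z in \<mu> R. norm (f z) \<le> C" and fm: "f \<in> borel_measurable (\<mu> R)"
    using f by (auto simp: Linf_annulus_def)
  have m: "(\<lambda>z. f z * h z) \<in> borel_measurable (\<mu> R)"
    by (intro borel_measurable_times fm L2_annulusD(1)[OF h])
  show ?thesis
  proof (rule L2_annulusI[OF m], rule Bochner_Integration.integrable_bound)
    show "integrable (\<mu> R) (\<lambda>z. C\<^sup>2 * (norm (h z))\<^sup>2)"
      using L2_annulusD[OF h] by simp
    show "(\<lambda>z. (norm (f z * h z))\<^sup>2) \<in> borel_measurable (\<mu> R)"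
      using m by measurable
    show "AE z in \<mu> R. norm ((norm (f z * h z))\<^sup>2) \<le> norm (C\<^sup>2 * (norm (h z))\<^sup>2)"
      using C
    proof eventually_elim
      case (elim z)
      have "(norm (f z))\<^sup>2 \<le> C\<^sup>2" using elim by (intro power_mono) auto
      thus ?case by (simp add: norm_mult power_mult_distrib mult_right_mono)
    qed
  qed
qed

lemma bergmanD:
  assumes "\<phi> \<in> bergman R"
  shows "\<phi> holomorphic_on annulus R" "\<phi> \<in> L2_annulus R" "z \<notin> annulus R \<Longrightarrow> \<phi> z = 0"
  using assms by (auto simp: bergman_def)

lemma bergman_scale: "\<phi> \<in> bergman R \<Longrightarrow> (\<lambda>z. c * \<phi> z) \<in> bergman R"
  by (auto simp: bergman_def intro!: holomorphic_intros L2_scale)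

lemma bergman_add: "\<phi> \<in> bergman R \<Longrightarrow> \<psi> \<in> bergman R \<Longrightarrow> (\<lambda>z. \<phi> z + \<psi> z) \<in> bergman R"
  by (auto simp: bergman_def intro!: holomorphic_intros L2_add)

lemma bergman_diff: "\<phi> \<in> bergman R \<Longrightarrow> \<psi> \<in> bergman R \<Longrightarrow> (\<lambda>z. \<phi> z - \<psi> z) \<in> bergman R"
  by (auto simp: bergman_def intro!: holomorphic_intros L2_diff)

lemma bergman_0: "(\<lambda>z. 0) \<in> bergman R"
  by (auto simp: bergman_def L2_annulus_def)

text \<open>The mean value bound applied to the holomorphic function \<open>\<phi>\<^sup>2\<close>: point evaluations are continuous on the Bergman
space, locally uniformly in the point.\<close>

lemma bergman_point_bound:
  assumes phi: "\<phi> \<in> bergman R" and B: "ball z \<rho> \<subseteq> annulus R" and rho: "\<rho> > 0"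
  shows "(norm (\<phi> z))\<^sup>2 * (pi * \<rho>\<^sup>2) \<le> sqnorm R \<phi>"
proof -
  have "(\<lambda>z. (\<phi> z)\<^sup>2) holomorphic_on annulus R"
    using bergmanD(1)[OF phi] by (intro holomorphic_intros)
  from holomorphic_mean_value_bound[OF this B rho]
  have "ennreal ((norm (\<phi> z))\<^sup>2 * (pi * \<rho>\<^sup>2)) \<le> (\<integral>\<^sup>+w. ennreal ((norm (\<phi> w))\<^sup>2) \<partial>\<mu> R)"
    by (simp add: norm_power)
  also have "\<dots> = ennreal (sqnorm R \<phi>)"
    unfolding sqnorm_def by (rule nn_integral_eq_integral[OF L2_annulusD(2)[OF bergmanD(2)[OF phi]]]) simp
  finally show ?thesis by (simp add: sqnorm_nonneg)
qed

lemma bergman_sqnorm_0: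
  assumes "\<phi> \<in> bergman R" "sqnorm R \<phi> = 0"
  shows "\<phi> = (\<lambda>z. 0)"
proof
  fix z
  show "\<phi> z = 0"
  proof (cases "z \<in> annulus R")
    case True
    obtain e where e: "e > 0" "ball z e \<subseteq> annulus R"
      using open_annulus True open_contains_ball by blast
    from bergman_point_bound[OF assms(1) e(2,1)] assms(2)
    have "(norm (\<phi> z))\<^sup>2 * (pi * e\<^sup>2) \<le> 0" by simp
    moreover have "pi * e\<^sup>2 > 0" using e by simp
    ultimately have "(norm (\<phi> z))\<^sup>2 \<le> 0" by (meson linorder_not_less mult_pos_pos)
    thus ?thesis by simp
  qed (rule bergmanD(3)[OF assms(1)])
qed

lemma inner_diff:
  assumes "h \<in> L2_annulus R" "k \<in> L2_annulus R" "\<phi> \<in> L2_annulus R"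
  shows "inner_annulus R (\<lambda>z. h z - k z) \<phi> = inner_annulus R h \<phi> - inner_annulus R k \<phi>"
  unfolding inner_annulus_def left_diff_distrib
  by (subst Bochner_Integration.integral_diff)
     (use assms in \<open>auto intro: L2_mult_cnj_integrable simp: diff_divide_distrib\<close>)

lemma inner_self: "inner_annulus R h h = of_real (sqnorm R h / (2 * pi))"
  unfolding inner_annulus_def sqnorm_def
  by (simp add: complex_norm_square[symmetric] flip: of_real_power)

lemma parallelogram:
  assumes h: "h \<in> L2_annulus R" and u: "u \<in> L2_annulus R" and v: "v \<in> L2_annulus R"
  shows "sqnorm R (\<lambda>z. u z - v z) + 4 * sqnorm R (\<lambda>z. h z - (1/2 * u z + 1/2 * v z)) =
    2 * sqnorm R (\<lambda>z. h z - u z) + 2 * sqnorm R (\<lambda>z. h z - v z)"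
proof -
  have L: "(\<lambda>z. u z - v z) \<in> L2_annulus R" "(\<lambda>z. h z - (1/2 * u z + 1/2 * v z)) \<in> L2_annulus R"
     "(\<lambda>z. h z - u z) \<in> L2_annulus R" "(\<lambda>z. h z - v z) \<in> L2_annulus R"
    by (intro L2_diff L2_add L2_scale assms)+
  have eq: "(norm (a - b))\<^sup>2 + 4 * (norm (c - (1/2 * a + 1/2 * b)))\<^sup>2 = 2 * (norm (c - a))\<^sup>2 + 2 * (norm (c - b))\<^sup>2"
    for a b c :: complex
    unfolding cmod_power2 by (simp add: power2_eq_square field_simps)
  have "(LINT z|\<mu> R. (norm (u z - v z))\<^sup>2 + 4 * (norm (h z - (1/2 * u z + 1/2 * v z)))\<^sup>2) =
      (LINT z|\<mu> R. 2 * (norm (h z - u z))\<^sup>2 + 2 * (norm (h z - v z))\<^sup>2)"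
    by (simp only: eq)
  thus ?thesis
    unfolding sqnorm_def using L[THEN L2_annulusD(2)]
    by (subst (asm) (1 2) Bochner_Integration.integral_add) auto
qed

text \<open>A sequence \<open>U n\<close> in the Bergman space whose distances to \<open>h\<close> tend to the infimum \<open>d\<close> is Cauchy by the parallelogram
law, hence locally uniformly Cauchy by the point bound.  Its pointwise limit is holomorphic, and Fatou's lemma shows that
it realises the minimum.  Orthogonality follows by varying the minimiser in the
direction of \<open>\<phi>\<close>.\<close>

lemma bergman_proj_exists:
  assumes h: "h \<in> L2_annulus R"
  shows "\<exists>u\<in>bergman R. \<forall>\<phi>\<in>bergman R. inner_annulus R (\<lambda>z. h z - u z) \<phi> = 0"
proof -
  define D where "D = (\<lambda>u. sqnorm R (\<lambda>z. h z - u z)) ` bergman R"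
  define d where "d = Inf D"
  have D_ne: "D \<noteq> {}" using bergman_0 by (auto simp: D_def)
  have D_bdd: "bdd_below D" by (rule bdd_belowI[of _ 0]) (auto simp: D_def sqnorm_nonneg)
  have d_le: "d \<le> sqnorm R (\<lambda>z. h z - u z)" if "u \<in> bergman R" for u
    unfolding d_def by (rule cInf_lower[OF _ D_bdd]) (use that in \<open>auto simp: D_def\<close>)
  have "\<exists>u\<in>bergman R. sqnorm R (\<lambda>z. h z - u z) < d + inverse (real (Suc n))" for n
  proof -
    have "Inf D < d + inverse (real (Suc n))" by (simp add: d_def)
    from cInf_lessD[OF D_ne this] show ?thesis by (auto simp: D_def)
  qed
  then obtain U where U: "\<And>n. U n \<in> bergman R"
    and Ud: "\<And>n. sqnorm R (\<lambda>z. h z - U n z) < d + inverse (real (Suc n))"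
    by metis
  have UL: "U n \<in> L2_annulus R" for n using bergmanD(2)[OF U] .
  have cauchy: "sqnorm R (\<lambda>z. U m z - U n z) \<le> 2 * inverse (real (Suc m)) + 2 * inverse (real (Suc n))" for m n
  proof -
    have "d \<le> sqnorm R (\<lambda>z. h z - (1/2 * U m z + 1/2 * U n z))"
      by (rule d_le) (intro bergman_add bergman_scale U)
    thus ?thesis using parallelogram[OF h UL[of m] UL[of n]] Ud[of m] Ud[of n] by linarith
  qed
  have unif: "\<exists>\<rho>>0. cball z0 \<rho> \<subseteq> annulus R \<and> uniform_limit (cball z0 \<rho>) U (\<lambda>z. lim (\<lambda>n. U n z)) sequentially"
    if z0: "z0 \<in> annulus R" for z0
  proof -
    obtain e where e: "e > 0" "ball z0 e \<subseteq> annulus R"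
      using open_annulus z0 open_contains_ball by blast
    define \<rho> where "\<rho> = e / 2"
    have rho: "\<rho> > 0" using e by (simp add: \<rho>_def)
    have sub: "ball z \<rho> \<subseteq> annulus R" if "z \<in> cball z0 \<rho>" for z
    proof
      fix w assume "w \<in> ball z \<rho>"
      hence "dist z0 w < e" using that dist_triangle[of z0 w z] by (simp add: \<rho>_def)
      thus "w \<in> annulus R" using e by auto
    qed
    have "uniformly_convergent_on (cball z0 \<rho>) U"
    proof (rule Cauchy_uniformly_convergent, rule uniformly_Cauchy_onI)
      fix \<epsilon> :: real assume eps: "\<epsilon> > 0"
      have P: "pi * \<rho>\<^sup>2 > 0" using rho by simp
      have "\<epsilon>\<^sup>2 * (pi * \<rho>\<^sup>2) / 4 > 0" using eps P by simp
      then obtain N where N: "inverse (real (Suc N)) < \<epsilon>\<^sup>2 * (pi * \<rho>\<^sup>2) / 4"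
        using reals_Archimedean by blast
      show "\<exists>M. \<forall>z\<in>cball z0 \<rho>. \<forall>m\<ge>M. \<forall>n\<ge>M. dist (U m z) (U n z) < \<epsilon>"
      proof (intro exI[of _ N] ballI allI impI)
        fix z m n assume z: "z \<in> cball z0 \<rho>" and mn: "N \<le> m" "N \<le> n"
        have inv: "inverse (real (Suc k)) \<le> inverse (real (Suc N))" if "N \<le> k" for k
          using that by (intro le_imp_inverse_le) auto
        have "(norm (U m z - U n z))\<^sup>2 * (pi * \<rho>\<^sup>2) \<le> sqnorm R (\<lambda>z. U m z - U n z)"
          by (rule bergman_point_bound[OF bergman_diff[OF U U] sub[OF z] rho])
        also have "\<dots> \<le> 4 * inverse (real (Suc N))"
          using cauchy[of m n] inv[OF mn(1)] inv[OF mn(2)] by linarith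
        also have "\<dots> < \<epsilon>\<^sup>2 * (pi * \<rho>\<^sup>2)" using N by linarith
        finally have "(norm (U m z - U n z))\<^sup>2 < \<epsilon>\<^sup>2" using P by (simp only: mult_less_cancel_right_pos)
        thus "dist (U m z) (U n z) < \<epsilon>"
          using eps power_less_imp_less_base[of "norm (U m z - U n z)" 2 \<epsilon>] by (simp add: dist_norm)
      qed
    qed
    hence "uniform_limit (cball z0 \<rho>) U (\<lambda>z. lim (\<lambda>n. U n z)) sequentially"
      by (simp add: uniformly_convergent_uniform_limit_iff)
    moreover have "cball z0 \<rho> \<subseteq> annulus R"
      using e by (auto simp: \<rho>_def)
    ultimately show ?thesis using rho by blast
  qed
  define u where "u = (\<lambda>z. lim (\<lambda>n. U n z))"
  have hol: "u holomorphic_on annulus R"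
    unfolding u_def
    by (rule holomorphic_uniform_sequence[OF open_annulus bergmanD(1)[OF U] unif])
  have lim: "(\<lambda>n. U n z) \<longlonglongrightarrow> u z" if z: "z \<in> annulus R" for z
  proof -
    obtain \<rho> where "\<rho> > 0" "uniform_limit (cball z \<rho>) U (\<lambda>z. lim (\<lambda>n. U n z)) sequentially"
      using unif[OF z] by blast
    thus ?thesis unfolding u_def by (intro tendsto_uniform_limitI[where x = z and S = "cball z \<rho>"]) auto
  qed
  have off: "u z = 0" if "z \<notin> annulus R" for z
    unfolding u_def using bergmanD(3)[OF U that] by (simp add: lim_const)
  have um: "u \<in> borel_measurable (\<mu> R)"
    by (rule continuous_imp_measurable_on_sets_lebesgue[OF holomorphic_on_imp_continuous_on[OF hol]]) simp
  have em: "(\<lambda>z. h z - u z) \<in> borel_measurable (\<mu> R)"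
    by (intro borel_measurable_diff L2_annulusD(1)[OF h] um)
  have fatou: "(\<integral>\<^sup>+z. ennreal ((norm (h z - u z))\<^sup>2) \<partial>\<mu> R) \<le> ennreal d"
  proof -
    have "(\<integral>\<^sup>+z. ennreal ((norm (h z - u z))\<^sup>2) \<partial>\<mu> R) =
        (\<integral>\<^sup>+z. liminf (\<lambda>n. ennreal ((norm (h z - U n z))\<^sup>2)) \<partial>\<mu> R)"
    proof (rule nn_integral_cong)
      fix z assume "z \<in> space (\<mu> R)"
      hence "(\<lambda>n. ennreal ((norm (h z - U n z))\<^sup>2)) \<longlonglongrightarrow> ennreal ((norm (h z - u z))\<^sup>2)"
        by (intro tendsto_intros lim) simp
      thus "ennreal ((norm (h z - u z))\<^sup>2) = liminf (\<lambda>n. ennreal ((norm (h z - U n z))\<^sup>2))"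
        by (intro lim_imp_Liminf[symmetric]) auto
    qed
    also have "\<dots> \<le> liminf (\<lambda>n. \<integral>\<^sup>+z. ennreal ((norm (h z - U n z))\<^sup>2) \<partial>\<mu> R)"
    proof (rule nn_integral_liminf)
      fix n
      have "(\<lambda>z. h z - U n z) \<in> borel_measurable (\<mu> R)"
        by (intro borel_measurable_diff L2_annulusD(1)[OF h] L2_annulusD(1)[OF UL])
      thus "(\<lambda>z. ennreal ((norm (h z - U n z))\<^sup>2)) \<in> borel_measurable (\<mu> R)"
        by measurable
    qed
    also have "\<dots> \<le> liminf (\<lambda>n. ennreal (d + inverse (real (Suc n))))"
    proof (rule Liminf_mono, rule always_eventually, rule allI)
      fix n
      have "(\<integral>\<^sup>+z. ennreal ((norm (h z - U n z))\<^sup>2) \<partial>\<mu> R) = ennreal (sqnorm R (\<lambda>z. h z - U n z))"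
        unfolding sqnorm_def by (rule nn_integral_eq_integral[OF L2_annulusD(2)[OF L2_diff[OF h UL]]]) simp
      thus "(\<integral>\<^sup>+z. ennreal ((norm (h z - U n z))\<^sup>2) \<partial>\<mu> R) \<le> ennreal (d + inverse (real (Suc n)))"
        using Ud[of n] by (simp add: ennreal_leI)
    qed
    also have "\<dots> = ennreal d"
    proof (rule lim_imp_Liminf)
      have "(\<lambda>n. d + inverse (real (Suc n))) \<longlonglongrightarrow> d + 0"
        by (intro tendsto_add tendsto_const LIMSEQ_inverse_real_of_nat)
      thus "(\<lambda>n. ennreal (d + inverse (real (Suc n)))) \<longlonglongrightarrow> ennreal d"
        by (intro tendsto_ennrealI) simp
    qed simp
    finally show ?thesis .
  qed
  have eL: "(\<lambda>z. h z - u z) \<in> L2_annulus R"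
  proof (rule L2_annulusI[OF em], rule integrableI_bounded)
    show "(\<lambda>z. (norm (h z - u z))\<^sup>2) \<in> borel_measurable (\<mu> R)"
      using em by measurable
    show "(\<integral>\<^sup>+z. ennreal (norm ((norm (h z - u z))\<^sup>2)) \<partial>\<mu> R) < \<infinity>"
      using fatou by (simp add: order_le_less_trans)
  qed
  have "u \<in> L2_annulus R"
    using L2_diff[OF h eL] by simp
  hence uB: "u \<in> bergman R"
    using hol off by (simp add: bergman_def)
  have d0: "d \<ge> 0" unfolding d_def by (rule cInf_greatest[OF D_ne]) (auto simp: D_def sqnorm_nonneg)
  have ud: "sqnorm R (\<lambda>z. h z - u z) \<le> d"
  proof -
    have "ennreal (sqnorm R (\<lambda>z. h z - u z)) = (\<integral>\<^sup>+z. ennreal ((norm (h z - u z))\<^sup>2) \<partial>\<mu> R)"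
      unfolding sqnorm_def by (rule nn_integral_eq_integral[OF L2_annulusD(2)[OF eL], symmetric]) simp
    hence "ennreal (sqnorm R (\<lambda>z. h z - u z)) \<le> ennreal d" using fatou by simp
    thus ?thesis by (simp only: ennreal_le_iff[OF d0])
  qed
  have "inner_annulus R (\<lambda>z. h z - u z) \<phi> = 0" if phi: "\<phi> \<in> bergman R" for \<phi>
  proof -
    define e where "e = (\<lambda>z. h z - u z)"
    define I where "I = (LINT z|\<mu> R. e z * cnj (\<phi> z))"
    define S where "S = sqnorm R \<phi>"
    have eL': "e \<in> L2_annulus R" using eL by (simp add: e_def)
    have pL: "\<phi> \<in> L2_annulus R" by (rule bergmanD(2)[OF phi])
    have int: "integrable (\<mu> R) (\<lambda>z. e z * cnj (\<phi> z))"
      by (rule L2_mult_cnj_integrable[OF eL' pL])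
    have key: "0 \<le> (norm t)\<^sup>2 * S - 2 * Re (cnj t * I)" for t
    proof -
      have eq: "(norm (a - t * b))\<^sup>2 = (norm a)\<^sup>2 - 2 * Re (cnj t * (a * cnj b)) + (norm t)\<^sup>2 * (norm b)\<^sup>2" for a b
        unfolding cmod_power2 by (simp add: power2_eq_square algebra_simps)
      have int2: "integrable (\<mu> R) (\<lambda>z. 2 * Re (cnj t * (e z * cnj (\<phi> z))))"
        by (intro integrable_mult_right integrable_Re int)
      have "sqnorm R (\<lambda>z. e z - t * \<phi> z) = sqnorm R e - (LINT z|\<mu> R. 2 * Re (cnj t * (e z * cnj (\<phi> z)))) + (norm t)\<^sup>2 * S"
        unfolding sqnorm_def S_def eq
        using int2 L2_annulusD(2)[OF eL'] L2_annulusD(2)[OF pL]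
        by (subst Bochner_Integration.integral_add) (auto simp: Bochner_Integration.integral_diff)
      also have "(LINT z|\<mu> R. 2 * Re (cnj t * (e z * cnj (\<phi> z)))) = 2 * Re (cnj t * I)"
        unfolding I_def using int
        by (simp only: integral_mult_right_zero integral_Re[OF integrable_mult_right[OF int]])
      finally have "sqnorm R (\<lambda>z. e z - t * \<phi> z) = sqnorm R e - 2 * Re (cnj t * I) + (norm t)\<^sup>2 * S" .
      moreover have "d \<le> sqnorm R (\<lambda>z. e z - t * \<phi> z)"
        using d_le[OF bergman_add[OF uB bergman_scale[OF phi, of t]]] by (simp add: e_def algebra_simps)
      ultimately show ?thesis using ud by (simp add: e_def)
    qed
    have S0: "S \<ge> 0" by (simp add: S_def sqnorm_nonneg)
    have "I = 0"
    proof (rule ccontr)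
      assume "I \<noteq> 0"
      \<comment> \<open>Along \<open>t = s I\<close> the quadratic term is of order \<open>s\<^sup>2\<close> and loses against the linear one once \<open>s S < 2\<close>.\<close>
      define s where "s = 1 / (S + 1)"
      have s: "s > 0" using S0 by (simp add: s_def)
      have sS: "s * S < 1" using S0 by (simp add: s_def field_simps)
      have "cnj (of_real s * I) * I = of_real (s * (norm I)\<^sup>2)"
        by (simp add: complex_norm_square mult_ac del: of_real_power)
      hence "Re (cnj (of_real s * I) * I) = s * (norm I)\<^sup>2"
        by (simp only: Re_complex_of_real)
      hence "0 \<le> s\<^sup>2 * (norm I)\<^sup>2 * S - 2 * (s * (norm I)\<^sup>2)"
        using key[of "of_real s * I"] by (simp add: norm_mult power_mult_distrib)
      also have "\<dots> = (s * (norm I)\<^sup>2) * (s * S - 2)"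
        by (simp add: power2_eq_square algebra_simps)
      finally have "0 \<le> (s * (norm I)\<^sup>2) * (s * S - 2)" .
      moreover have "s * (norm I)\<^sup>2 > 0" using s \<open>I \<noteq> 0\<close> by simp
      ultimately have "s * S - 2 \<ge> 0" by (simp add: zero_le_mult_iff)
      thus False using sS by simp
    qed
    thus ?thesis by (simp add: inner_annulus_def I_def e_def)
  qed
  thus ?thesis using uB by blast
qed

text \<open>Uniqueness holds because a Bergman function orthogonal to itself vanishes at every point by the point bound, and off
the annulus by the normalisation.\<close>

lemma bergman_proj:
  assumes h: "h \<in> L2_annulus R"
  shows "bergman_proj R h \<in> bergman R"
    and "\<And>\<phi>. \<phi> \<in> bergman R \<Longrightarrow> inner_annulus R (bergman_proj R h) \<phi> = inner_annulus R h \<phi>"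
proof -
  have "\<exists>!u. u \<in> bergman R \<and> (\<forall>\<phi>\<in>bergman R. inner_annulus R (\<lambda>z. h z - u z) \<phi> = 0)"
  proof (rule ex_ex1I)
    show "\<exists>u. u \<in> bergman R \<and> (\<forall>\<phi>\<in>bergman R. inner_annulus R (\<lambda>z. h z - u z) \<phi> = 0)"
      using bergman_proj_exists[OF h] by blast
  next
    fix u v
    assume u: "u \<in> bergman R \<and> (\<forall>\<phi>\<in>bergman R. inner_annulus R (\<lambda>z. h z - u z) \<phi> = 0)"
      and v: "v \<in> bergman R \<and> (\<forall>\<phi>\<in>bergman R. inner_annulus R (\<lambda>z. h z - v z) \<phi> = 0)"
    define w where "w = (\<lambda>z. u z - v z)"
    have wB: "w \<in> bergman R" unfolding w_def using u v by (intro bergman_diff) auto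
    note L = bergmanD(2)[OF wB] bergmanD(2)[of u R] bergmanD(2)[of v R]
    have uL: "u \<in> L2_annulus R" and vL: "v \<in> L2_annulus R"
      using u v L by auto
    have "inner_annulus R u w - inner_annulus R v w = 0"
      using u v wB inner_diff[OF h uL L(1)] inner_diff[OF h vL L(1)] by auto
    hence "inner_annulus R w w = 0"
      using u v L by (simp add: w_def inner_diff)
    hence "sqnorm R w = 0" by (simp add: inner_self)
    hence "w = (\<lambda>z. 0)" by (rule bergman_sqnorm_0[OF wB])
    thus "u = v" by (simp add: w_def fun_eq_iff)
  qed
  from theI'[OF this] have P: "bergman_proj R h \<in> bergman R"
    "\<And>\<phi>. \<phi> \<in> bergman R \<Longrightarrow> inner_annulus R (\<lambda>z. h z - bergman_proj R h z) \<phi> = 0"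
    unfolding bergman_proj_def by auto
  show "bergman_proj R h \<in> bergman R" by fact
  show "inner_annulus R (bergman_proj R h) \<phi> = inner_annulus R h \<phi>" if "\<phi> \<in> bergman R" for \<phi>
    using P(2)[OF that] inner_diff[OF h bergmanD(2)[OF P(1)] bergmanD(2)[OF that]] by simp
qed

section \<open>Functions whose moments vanish\<close>

text \<open>Orthogonality of \<open>h\<close> to all polynomials in \<open>X\<close> and its conjugate.  The three uses below take for \<open>X\<close> the coordinate
\<open>z\<close>, the squared modulus \<open>|z|\<^sup>2\<close>, and the point \<open>e\<^bsup>i\<theta>\<^esup>\<close> of the circle.\<close>

definition moment_null :: "'a measure \<Rightarrow> ('a \<Rightarrow> complex) \<Rightarrow> ('a \<Rightarrow> complex) \<Rightarrow> bool" where
  "moment_null M X h \<longleftrightarrow> integrable M h \<and>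
     (\<forall>a b. (LINT x|M. h x * (X x ^ a * cnj (X x) ^ b)) = 0)"

lemma integrable_mult_bounded:
  fixes h u :: "'a \<Rightarrow> complex"
  assumes h: "integrable M h" and u: "u \<in> borel_measurable M" and B: "\<And>x. x \<in> space M \<Longrightarrow> norm (u x) \<le> B"
  shows "integrable M (\<lambda>x. h x * u x)"
proof (rule Bochner_Integration.integrable_bound)
  show "integrable M (\<lambda>x. B * norm (h x))"
    using h by simp
  show "(\<lambda>x. h x * u x) \<in> borel_measurable M"
    using h u by measurable
  show "AE x in M. norm (h x * u x) \<le> norm (B * norm (h x))"
  proof (rule AE_I2)
    fix x assume x: "x \<in> space M"
    have "B \<ge> 0" using B[OF x] norm_ge_zero[of "u x"] by linarith
    thus "norm (h x * u x) \<le> norm (B * norm (h x))"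
      using mult_left_mono[OF B[OF x], of "norm (h x)"] by (simp add: norm_mult mult.commute)
  qed
qed

locale bounded_variable =
  fixes M :: "'a measure" and X :: "'a \<Rightarrow> complex" and B :: real
  assumes X_measurable: "X \<in> borel_measurable M"
    and X_bounded: "x \<in> space M \<Longrightarrow> norm (X x) \<le> B"
begin

lemma cnj_X_measurable: "(\<lambda>x. cnj (X x)) \<in> borel_measurable M"
  by (rule measurable_compose[OF X_measurable]) measurable

lemma integrable_moment:
  assumes "integrable M h"
  shows "integrable M (\<lambda>x. h x * (X x ^ a * cnj (X x) ^ b))"
proof (rule integrable_mult_bounded[OF assms])
  show "(\<lambda>x. X x ^ a * cnj (X x) ^ b) \<in> borel_measurable M"
    by (intro borel_measurable_times borel_measurable_power X_measurable cnj_X_measurable)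
  show "norm (X x ^ a * cnj (X x) ^ b) \<le> B ^ a * B ^ b" if "x \<in> space M" for x
    using X_bounded[OF that] order_trans[OF norm_ge_zero X_bounded[OF that]]
    by (auto simp: norm_mult norm_power intro!: mult_mono power_mono)
qed

lemma moment_null_add:
  assumes "moment_null M X h" "moment_null M X k"
  shows "moment_null M X (\<lambda>x. h x + k x)"
proof -
  have int: "integrable M h" "integrable M k"
    using assms by (auto simp: moment_null_def)
  show ?thesis
    unfolding moment_null_def distrib_right
    using assms
    by (auto simp: moment_null_def int Bochner_Integration.integral_add[OF integrable_moment integrable_moment])
qed

lemma moment_null_scale:
  assumes "moment_null M X h"
  shows "moment_null M X (\<lambda>x. h x * c)"
proof -
  have "(\<lambda>x. h x * c * (X x ^ a * cnj (X x) ^ b)) = (\<lambda>x. h x * (X x ^ a * cnj (X x) ^ b) * c)" for a b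
    by (simp add: mult_ac)
  thus ?thesis using assms unfolding moment_null_def by auto
qed

lemma moment_null_X:
  assumes "moment_null M X h"
  shows "moment_null M X (\<lambda>x. h x * X x)" "moment_null M X (\<lambda>x. h x * cnj (X x))"
proof -
  have eq: "(\<lambda>x. h x * X x * (X x ^ a * cnj (X x) ^ b)) = (\<lambda>x. h x * (X x ^ Suc a * cnj (X x) ^ b))"
    "(\<lambda>x. h x * cnj (X x) * (X x ^ a * cnj (X x) ^ b)) = (\<lambda>x. h x * (X x ^ a * cnj (X x) ^ Suc b))" for a b
    by (auto simp: mult_ac)
  have int: "integrable M h" and 0: "(LINT x|M. h x * (X x ^ a * cnj (X x) ^ b)) = 0" for a b
    using assms by (auto simp: moment_null_def)
  have "integrable M (\<lambda>x. h x * X x)" "integrable M (\<lambda>x. h x * cnj (X x))"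
    using integrable_moment[OF int, of 1 0] integrable_moment[OF int, of 0 1] by simp_all
  thus "moment_null M X (\<lambda>x. h x * X x)" "moment_null M X (\<lambda>x. h x * cnj (X x))"
    unfolding moment_null_def eq 0 by blast+
qed

text \<open>The class of functions with vanishing moments is a module over the polynomials, so induction on the polynomial
reduces the claim to multiplication by \<open>X\<close> and its conjugate.\<close>

lemma moment_null_real_polynomial:
  assumes "real_polynomial_function p" "moment_null M X h"
  shows "moment_null M X (\<lambda>x. h x * of_real (p (X x)))"
  using assms
proof (induction p arbitrary: h rule: real_polynomial_function.induct)
  case (linear f)
  interpret bounded_linear f by (rule linear)
  define c where "c = (of_real (f 1) - \<i> * of_real (f \<i>)) / 2"
  have fz: "f z = Re z * f 1 + Im z * f \<i>" for z
  proof -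
    have "f z = f (Re z *\<^sub>R 1 + Im z *\<^sub>R \<i>)"
      by (rule arg_cong[of _ _ f]) (simp add: complex_eq_iff)
    thus ?thesis by (simp only: add scale real_scaleR_def)
  qed
  have f: "of_real (f z) = z * c + cnj z * cnj c" for z
    unfolding c_def fz[of z] by (simp add: complex_eq_iff field_simps)
  have "moment_null M X (\<lambda>x. h x * X x * c + h x * cnj (X x) * cnj c)"
    by (intro moment_null_add moment_null_scale moment_null_X linear.prems)
  thus ?case by (simp add: f distrib_left mult.assoc)
next
  case (const c)
  show ?case by (rule moment_null_scale) fact
next
  case (add p q)
  from moment_null_add[OF add.IH(1)[OF add.prems] add.IH(2)[OF add.prems]]
  show ?case by (simp add: distrib_left)
next
  case (mult p q)
  from mult.IH(2)[OF mult.IH(1)[OF mult.prems]]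
  show ?case by (simp add: mult.assoc)
qed

lemma moment_null_polynomial:
  fixes p :: "complex \<Rightarrow> complex"
  assumes p: "polynomial_function p" and h: "moment_null M X h"
  shows "moment_null M X (\<lambda>x. h x * p (X x))"
proof -
  have Re: "real_polynomial_function (\<lambda>z. Re (p z))" and Im: "real_polynomial_function (\<lambda>z. Im (p z))"
    using p unfolding polynomial_function_def
    by (auto dest: spec[where x = Re] spec[where x = Im] simp: o_def bounded_linear_Re bounded_linear_Im)
  have "moment_null M X (\<lambda>x. h x * of_real (Re (p (X x))) + h x * of_real (Im (p (X x))) * \<i>)"
    by (intro moment_null_add moment_null_scale moment_null_real_polynomial Re Im h)
  moreover have "h x * of_real (Re (p (X x))) + h x * of_real (Im (p (X x))) * \<i> = h x * p (X x)" for x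
    by (simp add: complex_eq_iff algebra_simps)
  ultimately show ?thesis by simp
qed

text \<open>The Stone--Weierstrass theorem approximates \<open>q\<close> on \<open>K\<close> uniformly by polynomials in \<open>z\<close> and its conjugate;
integrating against \<open>h\<close> costs at most the uniform error times the integral of \<open>|h|\<close>.\<close>

lemma moment_null_continuous:
  fixes q :: "complex \<Rightarrow> complex"
  assumes h: "moment_null M X h" and K: "compact K" "\<And>x. x \<in> space M \<Longrightarrow> X x \<in> K"
    and q: "continuous_on K q"
  shows "(LINT x|M. h x * q (X x)) = 0"
proof -
  have int: "integrable M h" using h by (simp add: moment_null_def)
  have int_cont: "integrable M (\<lambda>x. h x * u (X x))" if u: "continuous_on K u" for u
  proof -
    obtain C where C: "\<And>z. z \<in> K \<Longrightarrow> norm (u z) \<le> C"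
      using compact_imp_bounded[OF compact_continuous_image[OF u K(1)]] by (auto simp: bounded_iff)
    show ?thesis
    proof (rule integrable_mult_bounded[OF int])
      show "norm (u (X x)) \<le> C" if "x \<in> space M" for x using C K(2)[OF that] .
      have "(\<lambda>x. indicator K (X x) *\<^sub>R u (X x)) \<in> borel_measurable M"
        using u K(1) by (intro measurable_compose[OF X_measurable borel_measurable_continuous_on_indicator])
          (auto intro: borel_compact)
      thus "(\<lambda>x. u (X x)) \<in> borel_measurable M"
        by (rule measurable_cong[THEN iffD1, rotated]) (simp add: K(2))
    qed
  qed
  have "norm (LINT x|M. h x * q (X x)) \<le> 0"
  proof (rule field_le_epsilon)
    fix e :: real assume e: "e > 0"
    define I where "I = (LINT x|M. norm (h x))"
    have I0: "I \<ge> 0" unfolding I_def by simp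
    define d where "d = e / (I + 1)"
    have d: "d > 0" using e I0 by (simp add: d_def)
    obtain p where p: "polynomial_function p" "\<And>z. z \<in> K \<Longrightarrow> norm (q z - p z) < d"
      using Stone_Weierstrass_polynomial_function[OF K(1) q d] by blast
    have pc: "continuous_on K p"
      using p(1) by (rule continuous_on_polymonial_function)
    have "moment_null M X (\<lambda>x. h x * p (X x))"
      by (rule moment_null_polynomial[OF p(1) h])
    hence "(LINT x|M. h x * p (X x) * (X x ^ 0 * cnj (X x) ^ 0)) = 0"
      unfolding moment_null_def by blast
    hence "(LINT x|M. h x * q (X x)) = (LINT x|M. h x * q (X x)) - (LINT x|M. h x * p (X x))"
      by simp
    also have "\<dots> = (LINT x|M. h x * q (X x) - h x * p (X x))"
      by (rule Bochner_Integration.integral_diff[symmetric, OF int_cont[OF q] int_cont[OF pc]])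
    also have "norm \<dots> \<le> (LINT x|M. norm (h x * q (X x) - h x * p (X x)))"
      by (rule integral_norm_bound)
    also have "\<dots> \<le> (LINT x|M. d * norm (h x))"
    proof (rule integral_mono)
      show "integrable M (\<lambda>x. norm (h x * q (X x) - h x * p (X x)))"
        by (intro integrable_norm Bochner_Integration.integrable_diff int_cont q pc)
      show "integrable M (\<lambda>x. d * norm (h x))" using int by simp
      show "norm (h x * q (X x) - h x * p (X x)) \<le> d * norm (h x)" if "x \<in> space M" for x
        using mult_left_mono[OF less_imp_le[OF p(2)[OF K(2)[OF that]]], of "norm (h x)"]
        by (simp add: right_diff_distrib[symmetric] norm_mult mult.commute)
    qed
    also have "\<dots> = d * I" by (simp add: I_def)
    also have "\<dots> \<le> e"
      using e I0 by (simp add: d_def field_simps)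
    finally show "norm (LINT x|M. h x * q (X x)) \<le> 0 + e" by simp
  qed
  thus ?thesis by simp
qed

end

section \<open>Symbols with vanishing moments\<close>

lemma annulus_nonzero: "0 < R \<Longrightarrow> z \<in> annulus R \<Longrightarrow> z \<noteq> 0"
  by (auto simp: annulus_def)

lemma Linf_borel:
  assumes "h \<in> borel_measurable borel" "\<And>z. norm (h z) \<le> C"
  shows "h \<in> Linf_annulus R"
  using assms by (auto simp: Linf_annulus_def intro!: borel_measurable_lebesgue_on exI[of _ C])

lemma Linf_integrable:
  assumes "h \<in> Linf_annulus R"
  shows "integrable (\<mu> R) h"
proof -
  obtain C where "AE z in \<mu> R. norm (h z) \<le> C"
    using assms by (auto simp: Linf_annulus_def)
  thus ?thesis
    using assms by (intro finite_measure.integrable_const_bound[OF finite_measure_annulus])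
      (auto simp: Linf_annulus_def)
qed

lemma powi_cnj_powi_measurable:
  "(\<lambda>z. z powi a * cnj z powi b) \<in> borel_measurable (\<mu> R)"
  by (rule borel_measurable_lebesgue_on) measurable

lemma powi_cnj_powi_bound:
  assumes R: "0 < R" and z: "z \<in> annulus R"
  shows "norm (z powi a * cnj z powi b) \<le> (1 + R powi a) * (1 + R powi b)"
  unfolding norm_mult norm_power_int complex_mod_cnj
  using z R by (intro mult_mono powi_le_on_radius add_nonneg_nonneg) (auto simp: annulus_def)

lemma moment_integrable:
  assumes R: "0 < R" and h: "h \<in> Linf_annulus R"
  shows "integrable (\<mu> R) (\<lambda>z. h z * (z powi a * cnj z powi b))"
  by (rule integrable_mult_bounded[OF Linf_integrable[OF h] powi_cnj_powi_measurable powi_cnj_powi_bound[OF R]])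
     simp

text \<open>The given moments are those of the measure \<open>h z\<^sup>a cnj(z)\<^sup>b dA\<close> with respect to the variable \<open>|z|\<^sup>2\<close>, so the
Stone--Weierstrass theorem on \<open>[R\<^sup>2, 1]\<close> applies.\<close>

lemma moment_radial_continuous:
  fixes q :: "real \<Rightarrow> complex"
  assumes R: "0 < R" and h: "h \<in> Linf_annulus R"
    and 0: "\<And>i :: nat. moment R h (a + int i) (b + int i) = 0"
    and q: "continuous_on {R\<^sup>2..1} q"
  shows "(LINT z|\<mu> R. h z * (z powi a * cnj z powi b) * q ((norm z)\<^sup>2)) = 0"
proof -
  define X where "X = (\<lambda>z::complex. of_real ((norm z)\<^sup>2) :: complex)"
  have Xm: "X \<in> borel_measurable (\<mu> R)"
    unfolding X_def by (rule borel_measurable_lebesgue_on) measurable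
  have range: "R\<^sup>2 \<le> (norm z)\<^sup>2" "(norm z)\<^sup>2 \<le> 1" if "z \<in> annulus R" for z
    using that R by (auto simp: annulus_def intro!: power_mono power_le_one)
  interpret bounded_variable "\<mu> R" X 1
    by unfold_locales (use Xm range in \<open>auto simp: X_def norm_power power_le_one annulus_def\<close>)
  let ?h = "\<lambda>z. h z * (z powi a * cnj z powi b)"
  have "moment_null (\<mu> R) X ?h"
    unfolding moment_null_def
  proof (intro conjI allI moment_integrable R h)
    fix i j :: nat
    have "(LINT z|\<mu> R. ?h z * (X z ^ i * cnj (X z) ^ j)) = moment R h (a + int (i + j)) (b + int (i + j))"
      unfolding moment_def
    proof (intro Bochner_Integration.integral_cong refl)
      fix z assume "z \<in> space (\<mu> R)"
      hence z: "z \<noteq> 0" using annulus_nonzero[OF R] by simp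
      have "X z ^ i * cnj (X z) ^ j = (z * cnj z) ^ (i + j)"
        unfolding X_def complex_norm_square by (simp add: power_add mult.commute)
      also have "\<dots> = z powi int (i + j) * cnj z powi int (i + j)"
        by (simp add: power_mult_distrib del: of_nat_add)
      finally show "?h z * (X z ^ i * cnj (X z) ^ j) =
          h z * (z powi (a + int (i + j)) * cnj z powi (b + int (i + j)))"
        using z by (simp add: power_int_add del: of_nat_add)
    qed
    thus "(LINT z|\<mu> R. ?h z * (X z ^ i * cnj (X z) ^ j)) = 0"
      by (simp only: 0)
  qed
  moreover have "compact (of_real ` {R\<^sup>2..1} :: complex set)"
    by (intro compact_continuous_image continuous_intros) simp
  moreover have "X z \<in> of_real ` {R\<^sup>2..1}" if "z \<in> space (\<mu> R)" for z
    using that range unfolding X_def by (intro imageI) auto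
  moreover have "continuous_on (of_real ` {R\<^sup>2..1}) (\<lambda>w. q (Re w))"
    by (intro continuous_on_compose2[OF q] continuous_intros) auto
  ultimately have "(LINT z|\<mu> R. ?h z * q (Re (X z))) = 0"
    by (rule moment_null_continuous)
  thus ?thesis by (simp only: X_def Re_complex_of_real)
qed

text \<open>Multiplying the integrand by \<open>(|z|\<^sup>2)\<^bsup>j-m\<^esup>\<close> turns the moment at \<open>m\<close> into the one at \<open>j\<close>.  As \<open>R > 0\<close>,
the function \<open>t\<^bsup>j-m\<^esup>\<close> is continuous on \<open>[R\<^sup>2, 1]\<close> also for \<open>j < m\<close>.\<close>

lemma moment_extend:
  assumes R: "0 < R" and h: "h \<in> Linf_annulus R"
    and 0: "\<And>j. j \<ge> m \<Longrightarrow> moment R h j (j + k) = 0"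
  shows "moment R h j (j + k) = 0"
proof -
  have "(LINT z|\<mu> R. h z * (z powi m * cnj z powi (m + k)) * of_real (((norm z)\<^sup>2) powi (j - m))) = 0"
  proof (rule moment_radial_continuous[OF R h])
    show "moment R h (m + int i) (m + k + int i) = 0" for i
      using 0[of "m + int i"] by (simp add: add_ac)
    show "continuous_on {R\<^sup>2..1} (\<lambda>t. complex_of_real (t powi (j - m)))"
      using R by (intro continuous_intros) auto
  qed
  also have "(LINT z|\<mu> R. h z * (z powi m * cnj z powi (m + k)) * of_real (((norm z)\<^sup>2) powi (j - m))) =
      moment R h j (j + k)"
    unfolding moment_def
  proof (intro Bochner_Integration.integral_cong refl)
    fix z assume "z \<in> space (\<mu> R)"
    hence z: "z \<noteq> 0" "cnj z \<noteq> 0" using annulus_nonzero[OF R] by auto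
    have "complex_of_real (((norm z)\<^sup>2) powi (j - m)) = (z * cnj z) powi (j - m)"
      by (simp only: of_real_power_int complex_norm_square)
    also have "\<dots> = z powi (j - m) * cnj z powi (j - m)"
      by (rule power_int_mult_distrib)
    finally have "z powi m * cnj z powi (m + k) * complex_of_real (((norm z)\<^sup>2) powi (j - m)) =
        (z powi m * z powi (j - m)) * (cnj z powi (m + k) * cnj z powi (j - m))"
      by (simp only: mult_ac)
    also have "\<dots> = z powi j * cnj z powi (j + k)"
      using z by (simp add: power_int_add[symmetric] add.commute del: complex_cnj_power_int)
    finally show "h z * (z powi m * cnj z powi (m + k)) * of_real (((norm z)\<^sup>2) powi (j - m)) =
        h z * (z powi j * cnj z powi (j + k))"
      by (simp only: mult.assoc)
  qed
  finally show ?thesis .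
qed

text \<open>All continuous functions are orthogonal to \<open>f\<close>.  The conjugate of \<open>f\<close> is an almost everywhere limit of continuous
functions, which may be truncated to the bound of \<open>f\<close>, so dominated convergence makes \<open>f\<close> orthogonal to itself.\<close>

lemma Linf_eq_0_of_moments:
  assumes R: "0 < R" and f: "f \<in> Linf_annulus R"
    and 0: "\<And>a b :: nat. moment R f (int a) (int b) = 0"
  shows "AE z in \<mu> R. f z = 0"
proof -
  obtain C0 where C0: "AE z in \<mu> R. norm (f z) \<le> C0" and fm: "f \<in> borel_measurable (\<mu> R)"
    using f by (auto simp: Linf_annulus_def)
  define C where "C = max C0 1"
  have C: "C > 0" and fC: "AE z in \<mu> R. norm (f z) \<le> C"
    using C0 by (auto simp: C_def elim: eventually_mono)
  interpret bounded_variable "\<mu> R" "\<lambda>z. z" 1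
    by unfold_locales (auto intro!: borel_measurable_lebesgue_on simp: annulus_def)
  have null: "moment_null (\<mu> R) (\<lambda>z. z) f"
    unfolding moment_null_def using Linf_integrable[OF f] 0 by (simp add: moment_def)
  have cont: "(LINT z|\<mu> R. f z * q z) = 0" if "continuous_on UNIV q" for q
    by (rule moment_null_continuous[OF null, of "cball 0 1" q])
       (use that in \<open>auto simp: annulus_def intro: continuous_on_subset\<close>)
  have cfm: "(\<lambda>z. cnj (f z)) \<in> borel_measurable (\<mu> R)"
    by (rule measurable_compose[OF fm]) measurable
  hence "(\<lambda>z. if z \<in> annulus R then cnj (f z) else 0) \<in> borel_measurable lebesgue"
    by (subst borel_measurable_if) auto
  hence "(\<lambda>z. if z \<in> annulus R then cnj (f z) else 0) measurable_on UNIV"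
    by (rule lebesgue_measurable_imp_measurable_on) simp
  hence "(\<lambda>z. cnj (f z)) measurable_on annulus R"
    by (simp only: measurable_on_UNIV)
  then obtain N g where N: "negligible N" and g: "\<And>n. continuous_on UNIV (g n)"
    and lim: "\<And>z. z \<notin> N \<Longrightarrow> (\<lambda>n::nat. g n z) \<longlonglongrightarrow> (if z \<in> annulus R then cnj (f z) else 0)"
    unfolding measurable_on_def by auto
  \<comment> \<open>Radial truncation: continuous, bounded by \<open>C\<close>, and the identity on the disc of radius \<open>C\<close>.\<close>
  define \<tau> where "\<tau> = (\<lambda>w :: complex. of_real (C / max C (norm w)) * w)"
  have tau_cont: "continuous_on UNIV \<tau>"
    unfolding \<tau>_def using C by (intro continuous_intros) (auto simp: max_def)
  have tau_le: "norm (\<tau> w) \<le> C" for w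
    using C by (auto simp: \<tau>_def norm_mult norm_divide max_def field_simps)
  have tau_eq: "\<tau> w = w" if "norm w \<le> C" for w
    using C that by (simp add: \<tau>_def max_def)
  have g_tau: "continuous_on UNIV (\<lambda>z. \<tau> (g n z))" for n
    by (rule continuous_on_compose2[OF tau_cont g]) simp
  have AE_N: "AE z in \<mu> R. z \<notin> N"
    using N by (subst AE_restrict_space_iff) (auto simp: negligible_iff_null_sets intro: AE_not_in eventually_mono)
  have AE_sp: "AE z in \<mu> R. z \<in> annulus R"
    using AE_space[of "\<mu> R"] by simp
  have int_g: "integrable (\<mu> R) (\<lambda>z. f z * \<tau> (g n z))" for n
    by (rule integrable_mult_bounded[OF Linf_integrable[OF f] _ tau_le])
       (intro borel_measurable_lebesgue_on borel_measurable_continuous_onI g_tau)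
  have "(\<lambda>n. LINT z|\<mu> R. f z * \<tau> (g n z)) \<longlonglongrightarrow> (LINT z|\<mu> R. f z * cnj (f z))"
  proof (rule integral_dominated_convergence[where w = "\<lambda>_. C * C"])
    show "(\<lambda>z. f z * cnj (f z)) \<in> borel_measurable (\<mu> R)"
      by (intro borel_measurable_times fm cfm)
    show "(\<lambda>z. f z * \<tau> (g n z)) \<in> borel_measurable (\<mu> R)" for n
      using int_g by (rule borel_measurable_integrable)
    show "integrable (\<mu> R) (\<lambda>_. C * C)"
      by (rule finite_measure.integrable_const[OF finite_measure_annulus])
    show "AE z in \<mu> R. norm (f z * \<tau> (g n z)) \<le> C * C" for n
      using fC by eventually_elim (use C tau_le in \<open>auto simp: norm_mult intro!: mult_mono\<close>)
    show "AE z in \<mu> R. (\<lambda>n. f z * \<tau> (g n z)) \<longlonglongrightarrow> f z * cnj (f z)"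
      using AE_N AE_sp fC
    proof eventually_elim
      case (elim z)
      have "(\<lambda>n. g n z) \<longlonglongrightarrow> cnj (f z)" using lim[OF elim(1)] elim(2) by simp
      hence "(\<lambda>n. \<tau> (g n z)) \<longlonglongrightarrow> \<tau> (cnj (f z))"
        by (intro continuous_on_tendsto_compose[OF tau_cont]) auto
      hence "(\<lambda>n. \<tau> (g n z)) \<longlonglongrightarrow> cnj (f z)" using elim(3) by (simp add: tau_eq)
      thus ?case by (intro tendsto_intros)
    qed
  qed
  hence "(\<lambda>n. 0) \<longlonglongrightarrow> (LINT z|\<mu> R. f z * cnj (f z))"
    by (simp add: cont[OF g_tau])
  hence "(LINT z|\<mu> R. f z * cnj (f z)) = 0"
    by (simp add: LIMSEQ_const_iff)
  hence "of_real (LINT z|\<mu> R. (norm (f z))\<^sup>2) = (0 :: complex)"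
    by (simp add: complex_norm_square[symmetric] del: of_real_power flip: integral_complex_of_real)
  hence 0: "(LINT z|\<mu> R. (norm (f z))\<^sup>2) = 0" by simp
  have "integrable (\<mu> R) (\<lambda>z. (norm (f z))\<^sup>2)"
  proof (rule finite_measure.integrable_const_bound[OF finite_measure_annulus, where B = "C\<^sup>2"])
    show "AE z in \<mu> R. norm ((norm (f z))\<^sup>2) \<le> C\<^sup>2"
      using fC by eventually_elim (auto intro!: power_mono)
  qed (use fm in measurable)
  from integral_nonneg_eq_0_iff_AE[OF this] 0
  have "AE z in \<mu> R. (norm (f z))\<^sup>2 = 0" by simp
  thus ?thesis by eventually_elim simp
qed

section \<open>Laurent monomials and coefficients of Bergman functions\<close>

definition laurent_monomial :: "real \<Rightarrow> int \<Rightarrow> complex \<Rightarrow> complex" where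
  "laurent_monomial R n = (\<lambda>z. if z \<in> annulus R then z powi n else 0)"

lemma laurent_monomial_bergman:
  assumes R: "0 < R"
  shows "laurent_monomial R n \<in> bergman R"
proof -
  have hol: "laurent_monomial R n holomorphic_on annulus R"
  proof (rule holomorphic_transform)
    show "(\<lambda>z. z powi n) holomorphic_on annulus R"
      using annulus_nonzero[OF R] by (intro holomorphic_intros) auto
  qed (simp add: laurent_monomial_def)
  have m: "laurent_monomial R n \<in> borel_measurable (\<mu> R)"
    unfolding laurent_monomial_def by (rule borel_measurable_lebesgue_on) measurable
  have "laurent_monomial R n \<in> L2_annulus R"
  proof (rule L2_annulusI[OF m], rule finite_measure.integrable_const_bound[OF finite_measure_annulus, where B = "(1 + R powi n)\<^sup>2"])
    show "AE z in \<mu> R. norm ((norm (laurent_monomial R n z))\<^sup>2) \<le> (1 + R powi n)\<^sup>2"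
    proof (rule AE_I2)
      fix z assume "z \<in> space (\<mu> R)"
      hence z: "z \<in> annulus R" by simp
      hence "norm (laurent_monomial R n z) \<le> 1 + R powi n"
        using powi_le_on_radius[OF R, of "norm z" n] by (simp add: laurent_monomial_def norm_power_int annulus_def)
      thus "norm ((norm (laurent_monomial R n z))\<^sup>2) \<le> (1 + R powi n)\<^sup>2"
        by (simp add: power_mono)
    qed
  qed (use m in measurable)
  thus ?thesis using hol by (simp add: bergman_def laurent_monomial_def)
qed

lemma inner_laurent_monomial:
  "inner_annulus R h (laurent_monomial R n) = 1 / (2 * of_real pi) * (LINT z|\<mu> R. h z * cnj z powi n)"
  unfolding inner_annulus_def
  by (rule arg_cong[where f = "\<lambda>x. 1 / (2 * of_real pi) * x"], rule Bochner_Integration.integral_cong)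
     (auto simp: laurent_monomial_def)

lemma laurent_monomial_norm_nonzero:
  assumes R: "0 < R" "R < 1"
  shows "(LINT z|\<mu> R. z powi n * cnj z powi n) \<noteq> 0"
proof
  assume 0: "(LINT z|\<mu> R. z powi n * cnj z powi n) = 0"
  have "(LINT z|\<mu> R. laurent_monomial R n z * cnj z powi n) = (LINT z|\<mu> R. z powi n * cnj z powi n)"
    by (rule Bochner_Integration.integral_cong) (auto simp: laurent_monomial_def)
  hence "inner_annulus R (laurent_monomial R n) (laurent_monomial R n) = 0"
    by (simp add: inner_laurent_monomial 0)
  hence "sqnorm R (laurent_monomial R n) = 0"
    by (simp add: inner_self)
  from bergman_sqnorm_0[OF laurent_monomial_bergman[OF R(1)] this]
  have mono0: "laurent_monomial R n z = 0" for z by simp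
  define x where "x = complex_of_real ((R + 1) / 2)"
  have "norm x = (R + 1) / 2"
    unfolding x_def norm_of_real using R by simp
  hence x: "x \<in> annulus R"
    using R by (simp add: annulus_def)
  show False
    using mono0[of x] x annulus_nonzero[OF R(1) x] by (simp add: laurent_monomial_def)
qed

text \<open>Borel measurability on the whole plane relies on the convention that Bergman functions vanish off the annulus.\<close>

lemma bergman_borel_measurable:
  assumes "w \<in> bergman R"
  shows "w \<in> borel_measurable borel"
proof -
  have "w = (\<lambda>z. indicator (annulus R) z *\<^sub>R w z)"
    using bergmanD(3)[OF assms] by (auto simp: fun_eq_iff indicator_def)
  thus ?thesis
    using borel_measurable_continuous_on_indicator[OF annulus_borel
        holomorphic_on_imp_continuous_on[OF bergmanD(1)[OF assms]]] by simp
qed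

text \<open>The number \<open>c\<close> is \<open>2 \<pi>\<close> times the \<open>k\<close>-th Laurent coefficient of \<open>w\<close>.\<close>

lemma bergman_circle_coefficient:
  assumes R: "0 < R" and w: "w \<in> bergman R"
  obtains c where "\<And>z. z \<in> annulus R \<Longrightarrow>
    (LINT \<theta>|lebesgue_on {0..2*pi}. w (cis \<theta> * z) * cis (- of_int k * \<theta>)) = c * z powi k"
proof -
  have hol: "(\<lambda>z. w z * z powi (- k)) holomorphic_on annulus R"
    using annulus_nonzero[OF R] bergmanD(1)[OF w] by (intro holomorphic_intros) auto
  obtain c where c: "\<And>z. z \<in> annulus R \<Longrightarrow>
      (LINT \<theta>|lebesgue_on {0..2*pi}. w (cis \<theta> * z) * (cis \<theta> * z) powi (- k)) = c"
    by (rule circle_mean_constant[OF open_annulus connected_annulus_complex _ hol]) (auto simp: annulus_rotate)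
  show ?thesis
  proof (rule that[of c])
    fix z assume z: "z \<in> annulus R"
    hence z0: "z \<noteq> 0" using annulus_nonzero[OF R] by simp
    have eq: "w (cis \<theta> * z) * (cis \<theta> * z) powi (- k) = w (cis \<theta> * z) * cis (- of_int k * \<theta>) * z powi (- k)" for \<theta>
      by (simp only: power_int_mult_distrib cis_power_int of_int_minus mult.assoc)
    hence "(LINT \<theta>|lebesgue_on {0..2*pi}. w (cis \<theta> * z) * cis (- of_int k * \<theta>)) * z powi (- k) = c"
      using c[OF z] by (simp only: eq integral_mult_left_zero)
    thus "(LINT \<theta>|lebesgue_on {0..2*pi}. w (cis \<theta> * z) * cis (- of_int k * \<theta>)) = c * z powi k"
      using z0 by (auto simp: power_int_minus field_simps)
  qed
qed

text \<open>Averaging the integral of \<open>w(z) cnj(z)\<^sup>k\<close> over rotations shows that it equals the \<open>k\<close>-th Laurent coefficient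
times the squared norm of \<open>z\<^sup>k\<close>.\<close>

lemma bergman_coefficient_zero:
  assumes R: "0 < R" "R < 1" and w: "w \<in> bergman R"
    and orth: "(LINT z|\<mu> R. w z * cnj z powi k) = 0"
    and z: "z \<in> annulus R"
  shows "(LINT \<theta>|lebesgue_on {0..2*pi}. w (cis \<theta> * z) * cis (- of_int k * \<theta>)) = 0"
proof -
  let ?\<nu> = "lebesgue_on {0..2*pi}"
  interpret pair_sigma_finite ?\<nu> "\<mu> R"
    unfolding pair_sigma_finite_def
    by (intro conjI finite_measure.axioms(1)[OF finite_measure_circle]
        finite_measure.axioms(1)[OF finite_measure_annulus])
  have [measurable]: "w \<in> borel_measurable borel"
    by (rule bergman_borel_measurable[OF w])
  have cis_powi: "cis (- of_int k * \<theta>) * cnj z powi k = cnj (cis \<theta> * z) powi k" for \<theta> z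
    by (simp only: complex_cnj_mult power_int_mult_distrib cis_cnj cis_power_int) (simp add: mult.commute)
  define F where "F = (\<lambda>\<theta> z. w (cis \<theta> * z) * cnj (cis \<theta> * z) powi k)"
  define G where "G = (\<lambda>z. w z * cnj z powi k)"
  have G [measurable]: "G \<in> borel_measurable borel"
    unfolding G_def by measurable
  have FG: "F \<theta> z = G (cis \<theta> * z)" for \<theta> z
    by (simp add: F_def G_def)
  have Gfin: "(\<integral>\<^sup>+z. ennreal (norm (G z)) \<partial>\<mu> R) < \<infinity>"
  proof -
    have "integrable (\<mu> R) (\<lambda>z. w z * cnj (laurent_monomial R k z))"
      by (intro L2_mult_cnj_integrable bergmanD(2) w laurent_monomial_bergman R)
    hence "integrable (\<mu> R) G"
      by (rule Bochner_Integration.integrable_cong[THEN iffD1, rotated 2])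
         (auto simp: G_def laurent_monomial_def)
    thus ?thesis by (simp add: integrable_iff_bounded)
  qed
  have Fm: "(\<lambda>(\<theta>, z). F \<theta> z) \<in> borel_measurable (?\<nu> \<Otimes>\<^sub>M \<mu> R)"
    unfolding FG by (rule borel_measurable_lebesgue_on_pair) measurable
  have Fint: "integrable (?\<nu> \<Otimes>\<^sub>M \<mu> R) (\<lambda>(\<theta>, z). F \<theta> z)"
  proof (rule integrableI_bounded[OF Fm])
    have Fm': "(\<lambda>p. ennreal (norm (case p of (\<theta>, z) \<Rightarrow> F \<theta> z))) \<in> borel_measurable (?\<nu> \<Otimes>\<^sub>M \<mu> R)"
      using Fm by measurable
    have "(\<integral>\<^sup>+p. ennreal (norm (case p of (\<theta>, z) \<Rightarrow> F \<theta> z)) \<partial>(?\<nu> \<Otimes>\<^sub>M \<mu> R)) =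
        (\<integral>\<^sup>+\<theta>. \<integral>\<^sup>+z. ennreal (norm (F \<theta> z)) \<partial>\<mu> R \<partial>?\<nu>)"
      using M2.nn_integral_fst[OF Fm'] by simp
    also have "\<dots> = (\<integral>\<^sup>+\<theta>. (\<integral>\<^sup>+z. ennreal (norm (G z)) \<partial>\<mu> R) \<partial>?\<nu>)"
      unfolding FG
      by (intro nn_integral_cong nn_integral_rotate_on[of "\<lambda>z. ennreal (norm (G z))"]) (auto simp: annulus_rotate)
    also have "\<dots> = (\<integral>\<^sup>+z. ennreal (norm (G z)) \<partial>\<mu> R) * ennreal (2 * pi)"
      by (subst nn_integral_const) (simp only: emeasure_circle)
    also have "\<dots> < \<infinity>"
      using Gfin by (simp add: ennreal_mult_less_top)
    finally show "(\<integral>\<^sup>+p. ennreal (norm (case p of (\<theta>, z) \<Rightarrow> F \<theta> z)) \<partial>(?\<nu> \<Otimes>\<^sub>M \<mu> R)) < \<infinity>" .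
  qed
  \<comment> \<open>Each rotated integrand has the integral of \<open>w z * cnj z powi k\<close>, which is zero; exchanging the order of
    integration exposes the Laurent coefficient.\<close>
  have inner0: "(LINT z|\<mu> R. F \<theta> z) = 0" for \<theta>
  proof -
    have "(LINT z|\<mu> R. G (cis \<theta> * z)) = (LINT z|\<mu> R. G z)"
      by (rule integral_rotate_on) (auto simp: annulus_rotate)
    thus ?thesis using orth by (simp add: FG G_def)
  qed
  obtain c where c: "\<And>z. z \<in> annulus R \<Longrightarrow>
      (LINT \<theta>|?\<nu>. w (cis \<theta> * z) * cis (- of_int k * \<theta>)) = c * z powi k"
    using bergman_circle_coefficient[OF R(1) w] by metis
  have "0 = (LINT \<theta>|?\<nu>. LINT z|\<mu> R. F \<theta> z)"
    by (simp add: inner0)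
  also have "\<dots> = (LINT z|\<mu> R. LINT \<theta>|?\<nu>. F \<theta> z)"
    by (rule Fubini_integral[OF Fint, symmetric])
  also have "\<dots> = (LINT z|\<mu> R. c * (z powi k * cnj z powi k))"
  proof (intro Bochner_Integration.integral_cong refl)
    fix z assume "z \<in> space (\<mu> R)"
    hence z: "z \<in> annulus R" by simp
    have "(LINT \<theta>|?\<nu>. F \<theta> z) = (LINT \<theta>|?\<nu>. w (cis \<theta> * z) * cis (- of_int k * \<theta>) * cnj z powi k)"
      unfolding F_def cis_powi[symmetric] by (simp only: mult.assoc)
    also have "\<dots> = (LINT \<theta>|?\<nu>. w (cis \<theta> * z) * cis (- of_int k * \<theta>)) * cnj z powi k"
      by (rule integral_mult_left_zero)
    finally show "(LINT \<theta>|?\<nu>. F \<theta> z) = c * (z powi k * cnj z powi k)"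
      by (simp only: c[OF z] mult.assoc)
  qed
  also have "\<dots> = c * (LINT z|\<mu> R. z powi k * cnj z powi k)"
    by (rule integral_mult_right_zero)
  finally have "c = 0"
    using laurent_monomial_norm_nonzero[OF R, of k] by (metis mult_eq_0_iff)
  thus ?thesis using c[OF z] by simp
qed

section \<open>Products of symbols with Bergman functions\<close>

text \<open>By density of trigonometric polynomials \<open>\<Phi>\<close> is orthogonal to itself on the circle, hence vanishes on it by
continuity.\<close>

lemma continuous_circle_fourier_zero:
  fixes \<Phi> :: "complex \<Rightarrow> complex"
  assumes cont: "continuous_on (sphere 0 1) \<Phi>"
    and 0: "\<And>k. (LINT \<theta>|lebesgue_on {0..2*pi}. \<Phi> (cis \<theta>) * cis (- of_int k * \<theta>)) = 0"
  shows "\<Phi> 1 = 0"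
proof -
  let ?\<nu> = "lebesgue_on {0..2*pi}"
  interpret bounded_variable ?\<nu> cis 1
    by unfold_locales (auto intro!: borel_measurable_lebesgue_on)
  have c1: "continuous_on {0..2*pi} (\<lambda>\<theta>. \<Phi> (cis \<theta>))"
    by (rule continuous_on_compose2[OF cont]) (auto intro!: continuous_intros)
  have "moment_null ?\<nu> cis (\<lambda>\<theta>. \<Phi> (cis \<theta>))"
    unfolding moment_null_def
  proof (intro conjI allI integrable_circle c1)
    fix a b :: nat
    have "cis \<theta> ^ a * cnj (cis \<theta>) ^ b = cis (- of_int (int b - int a) * \<theta>)" for \<theta>
      by (simp only: cis_cnj Complex.DeMoivre cis_mult) (rule arg_cong[where f = cis], simp add: algebra_simps)
    thus "(LINT \<theta>|?\<nu>. \<Phi> (cis \<theta>) * (cis \<theta> ^ a * cnj (cis \<theta>) ^ b)) = 0"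
      by (simp only: 0)
  qed
  hence "(LINT \<theta>|?\<nu>. \<Phi> (cis \<theta>) * cnj (\<Phi> (cis \<theta>))) = 0"
    by (rule moment_null_continuous[where K = "sphere 0 1" and q = "\<lambda>z. cnj (\<Phi> z)"])
       (use cont in \<open>auto intro!: continuous_intros\<close>)
  hence "of_real (LINT \<theta>|?\<nu>. (norm (\<Phi> (cis \<theta>)))\<^sup>2) = (0 :: complex)"
    by (simp add: complex_norm_square[symmetric] del: of_real_power flip: integral_complex_of_real)
  hence L0: "(LINT \<theta>|?\<nu>. (norm (\<Phi> (cis \<theta>)))\<^sup>2) = 0" by simp
  have c2: "continuous_on {0..2*pi} (\<lambda>\<theta>. (norm (\<Phi> (cis \<theta>)))\<^sup>2)"
    by (intro continuous_intros c1)
  have "integral {0..2*pi} (\<lambda>\<theta>. (norm (\<Phi> (cis \<theta>)))\<^sup>2) = 0"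
    using lebesgue_integral_eq_integral[OF continuous_imp_integrable_real[OF c2]] L0 by simp
  hence "\<forall>\<theta>\<in>{0..2*pi}. (norm (\<Phi> (cis \<theta>)))\<^sup>2 = 0"
    by (subst (asm) integral_eq_0_iff[OF c2]) auto
  hence "(norm (\<Phi> (cis 0)))\<^sup>2 = 0" by (rule bspec) simp
  thus ?thesis by simp
qed

text \<open>The function \<open>\<Phi> \<zeta> = \<integral> h(z) w(\<zeta> z) dA\<close> on the unit circle is continuous, and its \<open>k\<close>-th Fourier
coefficient is the \<open>k\<close>-th Laurent coefficient of \<open>w\<close> times \<open>\<integral> h(z) z\<^sup>k dA\<close>.  One of the two factors is
zero for each \<open>k\<close>, so that \<open>\<Phi> 1 = 0\<close>.  The compact support of \<open>h\<close> keeps the integrands bounded, since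
\<open>w\<close> may be unbounded near the boundary of the annulus.\<close>

lemma product_integral_zero_compact_support:
  fixes q :: "real \<Rightarrow> complex"
  assumes R: "0 < R" "R < 1" and w: "w \<in> bergman R"
    and h: "h \<in> borel_measurable borel" and C: "\<And>z. norm (h z) \<le> C"
    and worth: "\<And>j. j \<ge> J \<Longrightarrow> (LINT z|\<mu> R. w z * cnj z powi j) = 0"
    and h0: "\<And>j. j < J \<Longrightarrow> (LINT z|\<mu> R. h z * z powi j) = 0"
    and K: "compact K" "K \<subseteq> annulus R" "\<And>\<zeta> z. norm \<zeta> = 1 \<Longrightarrow> z \<in> K \<Longrightarrow> \<zeta> * z \<in> K"
    and supp: "\<And>z. z \<notin> K \<Longrightarrow> h z = 0"
  shows "(LINT z|\<mu> R. h z * w z) = 0"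
proof -
  let ?\<nu> = "lebesgue_on {0..2*pi}"
  interpret pair_sigma_finite ?\<nu> "\<mu> R"
    unfolding pair_sigma_finite_def
    by (intro conjI finite_measure.axioms(1)[OF finite_measure_circle]
        finite_measure.axioms(1)[OF finite_measure_annulus])
  have wm [measurable]: "w \<in> borel_measurable borel"
    by (rule bergman_borel_measurable[OF w])
  note h [measurable]
  have wcont: "continuous_on (annulus R) w"
    by (rule holomorphic_on_imp_continuous_on[OF bergmanD(1)[OF w]])
  obtain B where B: "\<And>z. z \<in> K \<Longrightarrow> norm (w z) \<le> B"
    using compact_imp_bounded[OF compact_continuous_image[OF continuous_on_subset[OF wcont K(2)] K(1)]]
    by (auto simp: bounded_iff)
  have C0: "C \<ge> 0" using C[of 0] norm_ge_zero order_trans by blast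
  have bd: "norm (h z * w (\<zeta> * z)) \<le> C * max B 0" if "norm \<zeta> = 1" for \<zeta> z
  proof (cases "z \<in> K")
    case True
    have "norm (w (\<zeta> * z)) \<le> max B 0" using B[OF K(3)[OF that True]] by simp
    thus ?thesis unfolding norm_mult using C C0 by (intro mult_mono) auto
  qed (use supp C0 in auto)
  define \<Phi> where "\<Phi> = (\<lambda>\<zeta>. LINT z|\<mu> R. h z * w (\<zeta> * z))"
  have meas: "(\<lambda>z. h z * w (\<zeta> * z)) \<in> borel_measurable (\<mu> R)" for \<zeta>
    by (rule borel_measurable_lebesgue_on) measurable
  have cont: "continuous_on (sphere 0 1) \<Phi>"
    unfolding continuous_on_sequentially
  proof (intro allI ballI impI)
    fix x :: "nat \<Rightarrow> complex" and a
    assume a: "a \<in> sphere 0 1" and x: "(\<forall>n. x n \<in> sphere 0 1) \<and> x \<longlonglongrightarrow> a"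
    show "(\<Phi> \<circ> x) \<longlonglongrightarrow> \<Phi> a"
      unfolding \<Phi>_def o_def
    proof (rule integral_dominated_convergence[where w = "\<lambda>_. C * max B 0"])
      show "integrable (\<mu> R) (\<lambda>_. C * max B 0)"
        by (rule finite_measure.integrable_const[OF finite_measure_annulus])
      show "AE z in \<mu> R. norm (h z * w (x n * z)) \<le> C * max B 0" for n
        using x by (intro AE_I2 bd) simp
      show "AE z in \<mu> R. (\<lambda>n. h z * w (x n * z)) \<longlonglongrightarrow> h z * w (a * z)"
      proof (rule AE_I2)
        fix z assume "z \<in> space (\<mu> R)"
        hence z: "z \<in> annulus R" by simp
        have "(\<lambda>n. w (x n * z)) \<longlonglongrightarrow> w (a * z)"
        proof (rule continuous_on_tendsto_compose[OF wcont])
          show "(\<lambda>n. x n * z) \<longlonglongrightarrow> a * z" using x by (intro tendsto_intros) simp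
          show "a * z \<in> annulus R" using a z by (simp add: annulus_rotate)
          show "\<forall>\<^sub>F n in sequentially. x n * z \<in> annulus R"
            using x z by (simp add: annulus_rotate)
        qed
        thus "(\<lambda>n. h z * w (x n * z)) \<longlonglongrightarrow> h z * w (a * z)" by (intro tendsto_intros)
      qed
    qed (rule meas)+
  qed
  have "(LINT \<theta>|?\<nu>. \<Phi> (cis \<theta>) * cis (- of_int k * \<theta>)) = 0" for k
  proof -
    define F where "F = (\<lambda>\<theta> z. h z * w (cis \<theta> * z) * cis (- of_int k * \<theta>))"
    have Fm: "(\<lambda>(\<theta>, z). F \<theta> z) \<in> borel_measurable (?\<nu> \<Otimes>\<^sub>M \<mu> R)"
      unfolding F_def by (rule borel_measurable_lebesgue_on_pair) measurable
    have Fint: "integrable (?\<nu> \<Otimes>\<^sub>M \<mu> R) (\<lambda>(\<theta>, z). F \<theta> z)"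
    proof (rule finite_measure.integrable_const_bound[OF _ _ Fm])
      show "finite_measure (?\<nu> \<Otimes>\<^sub>M \<mu> R)"
        by (rule finite_measure_pair_measure[OF finite_measure_annulus finite_measure_circle])
      show "AE p in ?\<nu> \<Otimes>\<^sub>M \<mu> R. norm (case p of (\<theta>, z) \<Rightarrow> F \<theta> z) \<le> C * max B 0"
      proof (rule AE_I2)
        fix p
        show "norm (case p of (\<theta>, z) \<Rightarrow> F \<theta> z) \<le> C * max B 0"
          using bd[of "cis (fst p)" "snd p"] by (simp add: F_def norm_mult case_prod_beta)
      qed
    qed
    obtain c where c: "\<And>z. z \<in> annulus R \<Longrightarrow>
        (LINT \<theta>|?\<nu>. w (cis \<theta> * z) * cis (- of_int k * \<theta>)) = c * z powi k"
      using bergman_circle_coefficient[OF R(1) w] by metis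
    have inner: "(LINT \<theta>|?\<nu>. F \<theta> z) = h z * (LINT \<theta>|?\<nu>. w (cis \<theta> * z) * cis (- of_int k * \<theta>))" for z
      unfolding F_def mult.assoc by (rule integral_mult_right_zero)
    have "(LINT \<theta>|?\<nu>. \<Phi> (cis \<theta>) * cis (- of_int k * \<theta>)) = (LINT \<theta>|?\<nu>. LINT z|\<mu> R. F \<theta> z)"
      unfolding F_def \<Phi>_def by simp
    also have "\<dots> = (LINT z|\<mu> R. LINT \<theta>|?\<nu>. F \<theta> z)"
      by (rule Fubini_integral[OF Fint, symmetric])
    also have "\<dots> = 0"
    proof (cases "k < J")
      case True
      have "(LINT z|\<mu> R. LINT \<theta>|?\<nu>. F \<theta> z) = (LINT z|\<mu> R. c * (h z * z powi k))"
      proof (intro Bochner_Integration.integral_cong refl)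
        fix z assume "z \<in> space (\<mu> R)"
        hence z: "z \<in> annulus R" by simp
        show "(LINT \<theta>|?\<nu>. F \<theta> z) = c * (h z * z powi k)"
          unfolding inner c[OF z] by (simp only: mult_ac)
      qed
      also have "\<dots> = c * (LINT z|\<mu> R. h z * z powi k)"
        by (rule integral_mult_right_zero)
      finally show ?thesis by (simp add: h0[OF True])
    next
      case False
      have "(LINT z|\<mu> R. LINT \<theta>|?\<nu>. F \<theta> z) = (LINT z|\<mu> R. 0)"
      proof (intro Bochner_Integration.integral_cong refl)
        fix z assume "z \<in> space (\<mu> R)"
        hence z: "z \<in> annulus R" by simp
        have "k \<ge> J" using False by simp
        show "(LINT \<theta>|?\<nu>. F \<theta> z) = 0"
          unfolding inner bergman_coefficient_zero[OF R w worth[OF \<open>k \<ge> J\<close>] z] by (rule mult_zero_right)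
      qed
      thus ?thesis by simp
    qed
    finally show ?thesis .
  qed
  from continuous_circle_fourier_zero[OF cont this] show ?thesis
    by (simp add: \<Phi>_def)
qed

lemma moment_cong_AE:
  assumes f: "f \<in> borel_measurable (\<mu> R)" and f': "f' \<in> borel_measurable (\<mu> R)"
    and AE: "AE z in \<mu> R. f z = f' z"
  shows "moment R f a b = moment R f' a b"
  unfolding moment_def
  by (rule integral_cong_AE)
     (use f f' in \<open>auto intro!: borel_measurable_times powi_cnj_powi_measurable\<close>,
      use AE in eventually_elim, simp)

lemma bergman_integrable:
  assumes R: "0 < R" and w: "w \<in> bergman R"
  shows "integrable (\<mu> R) w"
proof -
  have "integrable (\<mu> R) (\<lambda>z. w z * cnj (laurent_monomial R 0 z))"
    by (intro L2_mult_cnj_integrable bergmanD(2) w laurent_monomial_bergman R)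
  thus ?thesis
    by (rule Bochner_Integration.integrable_cong[THEN iffD1, rotated 2])
       (auto simp: laurent_monomial_def)
qed

text \<open>The support condition is removed by radial cutoffs.  Multiplying \<open>f\<close> by a continuous function of \<open>|z|\<^sup>2\<close> preserves
the vanishing of \<open>f0\<close>, because that hypothesis covers a whole ray of moments for each \<open>j\<close>.\<close>

lemma product_integral_zero:
  assumes R: "0 < R" "R < 1" and f: "f \<in> Linf_annulus R" and w: "w \<in> bergman R"
    and worth: "\<And>j. j \<ge> J \<Longrightarrow> (LINT z|\<mu> R. w z * cnj z powi j) = 0"
    and f0: "\<And>j i. j < J \<Longrightarrow> moment R f (j + int i) (p + int i) = 0"
  shows "(LINT z|\<mu> R. f z * w z * cnj z powi p) = 0"
proof -
  obtain f' C where f' [measurable]: "f' \<in> borel_measurable borel" and C: "\<And>z. norm (f' z) \<le> C"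
    and off: "\<And>z. z \<notin> annulus R \<Longrightarrow> f' z = 0" and AE: "AE z in \<mu> R. f z = f' z"
    using Linf_borel_representative[OF f] by metis
  have fm: "f \<in> borel_measurable (\<mu> R)" using f by (simp add: Linf_annulus_def)
  have f'm: "f' \<in> borel_measurable (\<mu> R)" by (rule borel_measurable_lebesgue_on[OF f'])
  have f'L: "f' \<in> Linf_annulus R" by (rule Linf_borel[OF f' C])
  have wm [measurable]: "w \<in> borel_measurable borel" by (rule bergman_borel_measurable[OF w])
  have C0: "C \<ge> 0" using C[of 0] norm_ge_zero order_trans by blast
  \<comment> \<open>The weight \<open>s\<close> is positive exactly for \<open>R\<^sup>2 < t < 1\<close>; thus \<open>q n\<close> increases to 1 on that interval, while
    \<open>q n (|z|\<^sup>2)\<close> is nonzero only on the compact subset \<open>K n\<close> of the open annulus.\<close>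
  define s where "s = (\<lambda>t. (t - R\<^sup>2) * (1 - t))"
  define q where "q = (\<lambda>n t. min 1 (max 0 (real n * s t - 1)))"
  define h where "h = (\<lambda>n z. f' z * cnj z powi p * of_real (q n ((norm z)\<^sup>2)))"
  define K where "K = (\<lambda>n. {z::complex. R \<le> norm z \<and> norm z \<le> 1 \<and> 1 \<le> real n * s ((norm z)\<^sup>2)})"
  have q01: "0 \<le> q n t" "q n t \<le> 1" for n t by (auto simp: q_def)
  have [measurable]: "s \<in> borel_measurable borel" unfolding s_def by measurable
  have [measurable]: "q n \<in> borel_measurable borel" for n unfolding q_def by measurable
  have hm: "h n \<in> borel_measurable borel" for n unfolding h_def by measurable
  have hb: "norm (h n z) \<le> C * (1 + R powi p)" for n z
  proof (cases "z \<in> annulus R")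
    case True
    have "norm (f' z) * norm z powi p \<le> C * (1 + R powi p)"
      using C C0 R True by (intro mult_mono powi_le_on_radius) (auto simp: annulus_def)
    moreover have "norm (f' z) * norm z powi p * \<bar>q n ((norm z)\<^sup>2)\<bar> \<le> norm (f' z) * norm z powi p * 1"
      using q01[of n "(norm z)\<^sup>2"] by (intro mult_left_mono) auto
    ultimately show ?thesis
      unfolding h_def norm_mult norm_power_int complex_mod_cnj norm_of_real by linarith
  qed (use R C0 off in \<open>simp add: h_def add_nonneg_nonneg\<close>)
  have "(LINT z|\<mu> R. h n z * w z) = 0" for n
  proof (rule product_integral_zero_compact_support[OF R w hm hb worth])
    fix j assume "j < J"
    have "(LINT z|\<mu> R. f' z * (z powi j * cnj z powi p) * of_real (q n ((norm z)\<^sup>2))) = 0"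
    proof (rule moment_radial_continuous[OF R(1) f'L])
      show "moment R f' (j + int i) (p + int i) = 0" for i
        using f0[OF \<open>j < J\<close>, of i] moment_cong_AE[OF fm f'm AE] by simp
      show "continuous_on {R\<^sup>2..1} (\<lambda>t. complex_of_real (q n t))"
        unfolding q_def s_def by (intro continuous_intros)
    qed
    thus "(LINT z|\<mu> R. h n z * z powi j) = 0"
      unfolding h_def by (simp only: mult_ac)
  next
    have "closed (K n)"
      unfolding K_def s_def by (intro closed_Collect_conj closed_Collect_le continuous_intros)
    moreover have "bounded (K n)"
      by (rule bounded_subset[OF bounded_cball[of 0 1]]) (auto simp: K_def)
    ultimately show "compact (K n)" by (simp add: compact_eq_bounded_closed)
    show "K n \<subseteq> annulus R"
    proof
      fix z assume z: "z \<in> K n"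
      hence "s ((norm z)\<^sup>2) \<noteq> 0" by (auto simp: K_def)
      hence "norm z \<noteq> R" "norm z \<noteq> 1" by (auto simp: s_def)
      thus "z \<in> annulus R" using z by (auto simp: K_def annulus_def)
    qed
    show "\<zeta> * z \<in> K n" if "norm \<zeta> = 1" "z \<in> K n" for \<zeta> z
      using that by (simp add: K_def norm_mult)
    show "h n z = 0" if "z \<notin> K n" for z
    proof (cases "z \<in> annulus R")
      case True
      hence "real n * s ((norm z)\<^sup>2) < 1" using that by (auto simp: K_def annulus_def)
      thus ?thesis by (simp add: h_def q_def)
    qed (simp add: h_def off)
  qed
  moreover have "(\<lambda>n. LINT z|\<mu> R. h n z * w z) \<longlonglongrightarrow> (LINT z|\<mu> R. f' z * w z * cnj z powi p)"
  proof (rule integral_dominated_convergence[where w = "\<lambda>z. C * (1 + R powi p) * norm (w z)"])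
    show "(\<lambda>z. f' z * w z * cnj z powi p) \<in> borel_measurable (\<mu> R)"
      by (rule borel_measurable_lebesgue_on) measurable
    show "(\<lambda>z. h n z * w z) \<in> borel_measurable (\<mu> R)" for n
      by (rule borel_measurable_lebesgue_on) (use hm in measurable)
    show "integrable (\<mu> R) (\<lambda>z. C * (1 + R powi p) * norm (w z))"
      using bergman_integrable[OF R(1) w] by simp
    show "AE z in \<mu> R. norm (h n z * w z) \<le> C * (1 + R powi p) * norm (w z)" for n
      unfolding norm_mult by (intro AE_I2 mult_right_mono hb) simp
    show "AE z in \<mu> R. (\<lambda>n. h n z * w z) \<longlonglongrightarrow> f' z * w z * cnj z powi p"
    proof (rule AE_I2)
      fix z assume "z \<in> space (\<mu> R)"
      hence z: "R < norm z" "norm z < 1" by (auto simp: annulus_def)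
      have "R\<^sup>2 < (norm z)\<^sup>2" using z R by (intro power_strict_mono) auto
      moreover have "(norm z)\<^sup>2 < 1" using z power_strict_mono[of "norm z" 1 2] by simp
      ultimately have s: "s ((norm z)\<^sup>2) > 0" by (simp add: s_def)
      obtain N :: nat where N: "real N * s ((norm z)\<^sup>2) > 2"
        using reals_Archimedean3[OF s] by blast
      have "eventually (\<lambda>n. h n z * w z = f' z * w z * cnj z powi p) sequentially"
        using eventually_ge_at_top[of N]
      proof eventually_elim
        case (elim n)
        have "real N * s ((norm z)\<^sup>2) \<le> real n * s ((norm z)\<^sup>2)"
          using elim s by (intro mult_right_mono) auto
        hence "q n ((norm z)\<^sup>2) = 1" using N by (simp add: q_def)
        thus ?case by (simp add: h_def mult_ac)
      qed
      thus "(\<lambda>n. h n z * w z) \<longlonglongrightarrow> f' z * w z * cnj z powi p"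
        by (rule tendsto_eventually)
    qed
  qed
  ultimately have "(LINT z|\<mu> R. f' z * w z * cnj z powi p) = 0"
    by (simp add: LIMSEQ_const_iff)
  moreover have "(LINT z|\<mu> R. f z * w z * cnj z powi p) = (LINT z|\<mu> R. f' z * w z * cnj z powi p)"
  proof (rule integral_cong_AE)
    have m: "(\<lambda>z. w z * cnj z powi p) \<in> borel_measurable (\<mu> R)"
      by (rule borel_measurable_lebesgue_on) measurable
    show "(\<lambda>z. f z * w z * cnj z powi p) \<in> borel_measurable (\<mu> R)"
      "(\<lambda>z. f' z * w z * cnj z powi p) \<in> borel_measurable (\<mu> R)"
      unfolding mult.assoc by (intro borel_measurable_times fm f'm m)+
    show "AE z in \<mu> R. f z * w z * cnj z powi p = f' z * w z * cnj z powi p"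
      using AE by eventually_elim simp
  qed
  ultimately show ?thesis by simp
qed

text \<open>A rotation by \<open>\<pi> / (m - n)\<close> changes the sign of the integrand.\<close>

lemma laurent_monomials_orthogonal:
  assumes R: "0 < R" and ne: "m \<noteq> n"
  shows "(LINT z|\<mu> R. z powi m * cnj z powi n) = 0"
proof -
  let ?I = "LINT z|\<mu> R. z powi m * cnj z powi n"
  define \<alpha> where "\<alpha> = pi / of_int (m - n)"
  have "of_int m * \<alpha> + - (of_int n * \<alpha>) = of_int (m - n) * \<alpha>"
    by (simp add: algebra_simps)
  also have "\<dots> = pi"
    unfolding \<alpha>_def using ne by (simp del: of_int_diff)
  finally have "cis (of_int m * \<alpha>) * cis (- (of_int n * \<alpha>)) = cis pi"
    by (simp only: cis_mult)
  hence rot: "(cis \<alpha> * z) powi m * cnj (cis \<alpha> * z) powi n = - (z powi m * cnj z powi n)" for z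
    unfolding complex_cnj_mult power_int_mult_distrib cis_cnj cis_power_int
    by (simp add: mult_ac)
  have "?I = (LINT z|\<mu> R. (cis \<alpha> * z) powi m * cnj (cis \<alpha> * z) powi n)"
    by (rule integral_rotate_on[of "\<lambda>z. z powi m * cnj z powi n", symmetric]) (auto simp: annulus_rotate)
  also have "\<dots> = - ?I"
    unfolding rot by (rule Bochner_Integration.integral_minus)
  finally show ?thesis by simp
qed

section \<open>Zero products of Toeplitz operators\<close>

text \<open>With \<open>J = n + N\<close>, the function \<open>u = T\<^sub>g z\<^sup>n\<close> has no Laurent terms beyond \<open>z\<^sup>J\<close>, and subtracting its top term
\<open>c z\<^sup>J\<close> leaves a function \<open>w\<close> orthogonal to \<open>z\<^sup>j\<close> for all \<open>j \<ge> J\<close>.  Multiplication by \<open>f\<close> sends \<open>w\<close> to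
something orthogonal to \<open>z\<^bsup>J+K\<^esup>\<close>, so \<open>\<langle>f u, z\<^bsup>J+K\<^esup>\<rangle> = 0\<close> reduces to \<open>c \<langle>f z\<^sup>J, z\<^bsup>J+K\<^esup>\<rangle> = 0\<close>.\<close>

lemma top_moment_zero:
  assumes R: "0 < R" "R < 1" and f: "f \<in> Linf_annulus R" and g: "g \<in> Linf_annulus R"
    and f0: "\<And>k j. k > K \<Longrightarrow> moment R f j (j + k) = 0"
    and g0: "\<And>k. k > N \<Longrightarrow> moment R g n (n + k) = 0"
    and gN: "moment R g n (n + N) \<noteq> 0"
    and T0: "toeplitz R f (toeplitz R g (laurent_monomial R n)) = (\<lambda>z. 0)"
  shows "moment R f (n + N) (n + N + K) = 0"
proof -
  define J where "J = n + N"
  define p where "p = J + K"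
  let ?e = "laurent_monomial R"
  have eB: "?e m \<in> bergman R" for m by (rule laurent_monomial_bergman[OF R(1)])
  have eL: "?e m \<in> L2_annulus R" for m by (rule bergmanD(2)[OF eB])
  define u where "u = toeplitz R g (?e n)"
  have gL: "(\<lambda>z. g z * ?e n z) \<in> L2_annulus R" by (rule Linf_mult_L2[OF g eL])
  have uB: "u \<in> bergman R"
    unfolding u_def toeplitz_def by (rule bergman_proj(1)[OF gL])
  have uL: "u \<in> L2_annulus R" by (rule bergmanD(2)[OF uB])
  have u_mom: "(LINT z|\<mu> R. u z * cnj z powi j) = moment R g n j" for j
  proof -
    have "inner_annulus R u (?e j) = inner_annulus R (\<lambda>z. g z * ?e n z) (?e j)"
      unfolding u_def toeplitz_def by (rule bergman_proj(2)[OF gL eB])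
    hence "(LINT z|\<mu> R. u z * cnj z powi j) = (LINT z|\<mu> R. g z * ?e n z * cnj z powi j)"
      by (simp add: inner_laurent_monomial)
    also have "\<dots> = moment R g n j"
      unfolding moment_def
      by (rule Bochner_Integration.integral_cong) (auto simp: laurent_monomial_def mult.assoc)
    finally show ?thesis .
  qed
  define S where "S = (LINT z|\<mu> R. z powi J * cnj z powi J)"
  have S: "S \<noteq> 0" unfolding S_def by (rule laurent_monomial_norm_nonzero[OF R])
  define c where "c = moment R g n J / S"
  have c: "c \<noteq> 0" using S gN by (simp add: c_def J_def)
  define w where "w = (\<lambda>z. u z - c * ?e J z)"
  have wB: "w \<in> bergman R" unfolding w_def by (intro bergman_diff bergman_scale uB eB)
  have int: "integrable (\<mu> R) (\<lambda>z. v z * cnj z powi j)" if v: "v \<in> L2_annulus R" for v j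
    by (rule Bochner_Integration.integrable_cong[THEN iffD1, rotated 2, OF L2_mult_cnj_integrable[OF v eL[of j]]])
       (auto simp: laurent_monomial_def)
  have worth: "(LINT z|\<mu> R. w z * cnj z powi j) = 0" if j: "j \<ge> J" for j
  proof -
    have "(LINT z|\<mu> R. w z * cnj z powi j) = (LINT z|\<mu> R. u z * cnj z powi j - c * (?e J z * cnj z powi j))"
      unfolding w_def by (simp only: left_diff_distrib mult.assoc)
    also have "\<dots> = (LINT z|\<mu> R. u z * cnj z powi j) - (LINT z|\<mu> R. c * (?e J z * cnj z powi j))"
      by (intro Bochner_Integration.integral_diff integrable_mult_right int uL eL)
    also have "(LINT z|\<mu> R. c * (?e J z * cnj z powi j)) = c * (LINT z|\<mu> R. ?e J z * cnj z powi j)"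
      by (rule integral_mult_right_zero)
    also have "(LINT z|\<mu> R. ?e J z * cnj z powi j) = (LINT z|\<mu> R. z powi J * cnj z powi j)"
      by (rule Bochner_Integration.integral_cong) (auto simp: laurent_monomial_def)
    finally have eq: "(LINT z|\<mu> R. w z * cnj z powi j) = moment R g n j - c * (LINT z|\<mu> R. z powi J * cnj z powi j)"
      by (simp only: u_mom)
    show ?thesis
    proof (cases "j = J")
      case True
      thus ?thesis unfolding eq using S by (simp add: c_def S_def)
    next
      case False
      hence "moment R g n (n + (j - n)) = 0" using j by (intro g0) (simp add: J_def)
      thus ?thesis unfolding eq using laurent_monomials_orthogonal[OF R(1), of J j] False by simp
    qed
  qed
  have fw: "(LINT z|\<mu> R. f z * w z * cnj z powi p) = 0"
  proof (rule product_integral_zero[OF R f wB worth])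
    fix j i assume "j < J"
    hence "moment R f (j + int i) (j + int i + (p - j)) = 0"
      by (intro f0) (simp add: p_def)
    thus "moment R f (j + int i) (p + int i) = 0" by (simp add: add_ac)
  qed
  have fu: "(LINT z|\<mu> R. f z * u z * cnj z powi p) = 0"
  proof -
    have L: "(\<lambda>z. f z * u z) \<in> L2_annulus R" by (rule Linf_mult_L2[OF f uL])
    have "bergman_proj R (\<lambda>z. f z * u z) = (\<lambda>z. 0)"
      using T0 by (simp add: u_def toeplitz_def)
    hence "inner_annulus R (\<lambda>z. f z * u z) (?e p) = 0"
      using bergman_proj(2)[OF L eB[of p]] by (simp add: inner_laurent_monomial)
    thus ?thesis by (simp add: inner_laurent_monomial)
  qed
  have "(LINT z|\<mu> R. f z * u z * cnj z powi p) =
      (LINT z|\<mu> R. f z * w z * cnj z powi p + c * (f z * ?e J z * cnj z powi p))"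
    unfolding w_def by (simp add: algebra_simps)
  also have "\<dots> = (LINT z|\<mu> R. f z * w z * cnj z powi p) + (LINT z|\<mu> R. c * (f z * ?e J z * cnj z powi p))"
    by (intro Bochner_Integration.integral_add integrable_mult_right int Linf_mult_L2 f eL bergmanD(2) wB)
  also have "\<dots> = c * (LINT z|\<mu> R. f z * ?e J z * cnj z powi p)"
    by (simp only: fw integral_mult_right_zero add_0)
  also have "(LINT z|\<mu> R. f z * ?e J z * cnj z powi p) = moment R f J p"
    unfolding moment_def
    by (rule Bochner_Integration.integral_cong) (auto simp: laurent_monomial_def mult.assoc)
  finally have "c * moment R f J p = 0" using fu by simp
  thus ?thesis using c by (simp add: J_def p_def)
qed

theorem theorem3p8:
  fixes R :: real and f g :: "complex \<Rightarrow> complex" and M N n0 :: int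
  assumes "0 < R" and "R < 1"
    and "f \<in> Linf_annulus R" and "g \<in> Linf_annulus R"
    and "\<And>k. k > M \<Longrightarrow> AE r in lebesgue_on {R..1}. polar_coeff f k r = 0"
    and "\<And>k. k > N \<Longrightarrow> AE r in lebesgue_on {R..1}. polar_coeff g k r = 0"
    and "\<forall>n\<ge>n0. mellin R (polar_coeff g N) (of_int (2 * n + N + 2)) \<noteq> 0"
    and "\<And>m. (\<forall>n\<ge>m. mellin R (polar_coeff g N) (of_int (2 * n + N + 2)) \<noteq> 0) \<Longrightarrow> n0 \<le> m"
    and "\<forall>\<phi>\<in>bergman R. toeplitz R f (toeplitz R g \<phi>) = (\<lambda>z. 0)"
  shows "AE z in lebesgue_on (annulus R). f z = 0"
proof -
  note R = assms(1,2) and f = assms(3) and g = assms(4)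
  have f0: "moment R f j (j + k) = 0" if "k > M" for j k
    by (rule moment_eq_0_polar[OF R(1) f assms(5)[OF that]])
  have g0: "moment R g j (j + k) = 0" if "k > N" for j k
    by (rule moment_eq_0_polar[OF R(1) g assms(6)[OF that]])
  have gN: "moment R g n (n + N) \<noteq> 0" if "n \<ge> n0" for n
    unfolding moment_eq_mellin[OF R(1) g] using assms(7) that by simp
  have step: "moment R f j (j + K) = 0" if IH: "\<And>k j. k > K \<Longrightarrow> moment R f j (j + k) = 0" for K j
  proof (rule moment_extend[OF R(1) f])
    fix J assume "J \<ge> n0 + N"
    have "moment R f (J - N + N) (J - N + N + K) = 0"
    proof (rule top_moment_zero[OF R f g IH g0])
      show "moment R g (J - N) (J - N + N) \<noteq> 0" by (rule gN) (use \<open>J \<ge> n0 + N\<close> in simp)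
      show "toeplitz R f (toeplitz R g (laurent_monomial R (J - N))) = (\<lambda>z. 0)"
        using assms(9) laurent_monomial_bergman[OF R(1)] by blast
    qed
    thus "moment R f J (J + K) = 0" by simp
  qed
  have all: "\<forall>k>M - int n. \<forall>j. moment R f j (j + k) = 0" for n
  proof (induction n)
    case 0
    show ?case using f0 by simp
  next
    case (Suc n)
    have "moment R f j (j + k) = 0" if "k > M - int (Suc n)" for k j
    proof (cases "k > M - int n")
      case True
      thus ?thesis using Suc.IH by blast
    next
      case False
      hence "k = M - int n" using that by simp
      thus ?thesis using step[of k j] Suc.IH by blast
    qed
    thus ?case by blast
  qed
  show ?thesis
  proof (rule Linf_eq_0_of_moments[OF R(1) f])
    fix a b :: nat
    have "int b - int a > M - int (nat (M - (int b - int a)) + 1)" by simp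
    hence "moment R f (int a) (int a + (int b - int a)) = 0" using all by blast
    thus "moment R f (int a) (int b) = 0" by simp
  qed
qed

end
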